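(* Let $k_0>0$, let $\mu_n$ ($n\in\mathbb{N}$) be complex Borel measures on the closed ball $\{\mathbf{k}\in\mathbb{R}^2:|\mathbf{k}|\le k_0\}$, and set $F_n(\mathbf{z})=\int_{|\mathbf{k}|\le k_0}e^{i\mathbf{k}\mathbf{z}}d\mu_n(\mathbf{k})$, $\mathbf{z}\in\mathbb{C}^2$. Suppose there is $\mathbf{a}\in\mathbb{R}^2$ with $|\mathbf{a}|>k_0$ such that $F_n\to e^{i\mathbf{a}\,\cdot}$ in $\mathcal{A}_1(\mathbb{C}^2)$. Then for all $t>0$, $\mathbf{x}\in\Omega$ and $n\in\mathbb{N}$, $$\Psi_{D,N}(t,\mathbf{x};F_n)=\int_{|\mathbf{k}|\le k_0}\Psi_{D,N}\big(t,\mathbf{x};e^{i\mathbf{k}\,\cdot}\big)\,d\mu_n(\mathbf{k}),$$ and $\lim_{n\to\infty}\Psi_{D,N}(t,\mathbf{x};F_n)=\Psi_{D,N}(t,\mathbf{x};e^{i\mathbf{a}\,\cdot})$ uniformly on compact subsets of $(0,\infty)\times\Omega$. In other words, the sequence $(\Psi_{D,N}(\cdot,\cdot;F_n))_n$ admits a supershift on $X=(0,\infty)\times\Omega$ with respect to the family $\varphi_{\mathbf{k}}(t,\mathbf{x})=\Psi_{D,N}(t,\mathbf{x};e^{i\mathbf{k}\,\cdot})$.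
   Context: Here $\mathbf{k}\mathbf{z}=k_1z_1+k_2z_2$ (bilinear), $e^{i\mathbf{k}\,\cdot}$ denotes the function $\mathbf{z}\mapsto e^{i\mathbf{k}\mathbf{z}}$, and $|\mathbf{z}|=\sqrt{|z_1|^2+|z_2|^2}$. Let $\Gamma=\{(0,x_2):x_2\le0\}$, $\Omega=\mathbb{R}^2\setminus\Gamma$; write $\mathbf{x}\in\Omega$ as $\mathbf{x}=r(\cos\varphi,\sin\varphi)$, $r>0$, $\varphi\in(-\frac{\pi}{2},\frac{3\pi}{2})$. $\mathcal{A}_1(\mathbb{C}^2)$ is the space of entire $F:\mathbb{C}^2\to\mathbb{C}$ with $|F(\mathbf{z})|\le Ae^{B|\mathbf{z}|}$ for some $A,B\ge0$; $F_n\to F_0$ in $\mathcal{A}_1(\mathbb{C}^2)$ means there is $B\ge0$ with $\lim_{n}\sup_{\mathbf{z}\in\mathbb{C}^2}|F_n(\mathbf{z})-F_0(\mathbf{z})|e^{-B|\mathbf{z}|}=0$. Let $\Lambda(z)=\frac{2}{\sqrt{\pi}}\int_0^\infty e^{-s^2-2zs}ds$. For $t>0$, $\mathbf{x}\in\Omega$, $\mathbf{y}=\rho(\cos\theta,\sin\theta)\in\Omega$ ($\rho>0$, $\theta\in(-\frac{\pi}{2},\frac{3\pi}{2})$) the Green's functions of $i\partial_t\Psi=-\Delta\Psi$ on $\Omega$ with Dirichlet ($\Psi=0$, index $D$) resp. Neumann ($\partial_{x_1}\Psi=0$, index $N$) condition on $\Gamma$ are $$G_{D,N}(t,\mathbf{x},\mathbf{y})=\frac{e^{-\frac{(r+\rho)^2}{4it}}}{8i\pi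 t}\Big(\Lambda\Big(\tfrac{\sqrt{r\rho}\cos(\frac{\varphi-\theta}{2})}{\sqrt{it}}\Big)\mp\Lambda\Big(-\tfrac{\sqrt{r\rho}\sin(\frac{\varphi+\theta}{2})}{\sqrt{it}}\Big)\Big)$$ ($-$ for $D$, $+$ for $N$, $\sqrt{it}$ principal). For $F\in\mathcal{A}_1(\mathbb{C}^2)$ the wave function is $\Psi_{D,N}(t,\mathbf{x};F)=\lim_{\varepsilon\to0^+}\int_\Omega e^{-\varepsilon|\mathbf{y}|^2}G_{D,N}(t,\mathbf{x},\mathbf{y})F(\mathbf{y})d\mathbf{y}$ (the limit exists). Supershift: given a metric space $X$ and functions $\varphi_{\mathbf{k}}:X\to\mathbb{C}$ with $\mathbf{k}\mapsto\varphi_{\mathbf{k}}(s)$ continuous, a sequence $\Phi_n(s)=\int_{|\mathbf{k}|\le k_0}\varphi_{\mathbf{k}}(s)d\mu_n(\mathbf{k})$ admits a supershift if there is $\mathbf{a}$ with $|\mathbf{a}|>k_0$ such that $\Phi_n\to\varphi_{\mathbf{a}}$ uniformly on compact subsets of $X$. *)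

theory Defs
  imports "HOL-Analysis.Analysis"
begin

text \<open>Points of R^2 are pairs of reals; points of C^2 are pairs of complex numbers.
  The product norm is sqrt(|z1|^2+|z2|^2), i.e. the Euclidean norm.\<close>

type_synonym R2 = "real \<times> real"
type_synonym C2 = "complex \<times> complex"

datatype bc = Dirichlet | Neumann

definition embC2 :: "R2 \<Rightarrow> C2" where
  "embC2 y = (complex_of_real (fst y), complex_of_real (snd y))"

definition pw :: "R2 \<Rightarrow> C2 \<Rightarrow> complex" where
  "pw k z = exp (\<i> * (complex_of_real (fst k) * fst z + complex_of_real (snd k) * snd z))"

definition A1_conv :: "(nat \<Rightarrow> C2 \<Rightarrow> complex) \<Rightarrow> (C2 \<Rightarrow> complex) \<Rightarrow> bool" where
  "A1_conv Fs F0 \<longleftrightarrow> (\<exists>B\<ge>0. \<forall>\<epsilon>>0. \<forall>\<^sub>F n in sequentially.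
       \<forall>z. norm (Fs n z - F0 z) * exp (- B * norm z) \<le> \<epsilon>)"

definition Gamma_cut :: "R2 set" where
  "Gamma_cut = {y. fst y = 0 \<and> snd y \<le> 0}"

definition Omega :: "R2 set" where
  "Omega = UNIV - Gamma_cut"

definition ang :: "R2 \<Rightarrow> real" where
  "ang x = (THE \<phi>. - pi/2 < \<phi> \<and> \<phi> < 3*pi/2 \<and> x = (norm x * cos \<phi>, norm x * sin \<phi>))"

definition Lam :: "complex \<Rightarrow> complex" where
  "Lam z = complex_of_real (2 / sqrt pi) *
     (LINT s:{0..}|lborel. exp (- (complex_of_real s)\<^sup>2 - 2 * z * complex_of_real s))"

definition bsign :: "bc \<Rightarrow> complex" where
  "bsign b = (case b of Dirichlet \<Rightarrow> -1 | Neumann \<Rightarrow> 1)"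

definition Green :: "bc \<Rightarrow> real \<Rightarrow> R2 \<Rightarrow> R2 \<Rightarrow> complex" where
  "Green b t x y =
    (let r = norm x; \<rho> = norm y; \<phi> = ang x; \<theta> = ang y; s = csqrt (\<i> * complex_of_real t) in
     exp (- complex_of_real ((r + \<rho>)\<^sup>2) / (4 * \<i> * complex_of_real t))
       / (8 * \<i> * complex_of_real pi * complex_of_real t)
     * (Lam (complex_of_real (sqrt (r * \<rho>) * cos ((\<phi> - \<theta>) / 2)) / s)
        + bsign b * Lam (- complex_of_real (sqrt (r * \<rho>) * sin ((\<phi> + \<theta>) / 2)) / s)))"

definition Psi :: "bc \<Rightarrow> real \<Rightarrow> R2 \<Rightarrow> (C2 \<Rightarrow> complex) \<Rightarrow> complex" where
  "Psi b t x F = Lim (at_right (0::real))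
     (\<lambda>\<epsilon>. LINT y:Omega|lborel.
        complex_of_real (exp (- \<epsilon> * (norm y)\<^sup>2)) * Green b t x y * F (embC2 y))"

text \<open>Integration against the complex Borel measure h dM on the closed ball of radius k0.\<close>
definition cball_int :: "real \<Rightarrow> R2 measure \<Rightarrow> (R2 \<Rightarrow> complex) \<Rightarrow> (R2 \<Rightarrow> complex) \<Rightarrow> complex" where
  "cball_int k0 M h f = (LINT k:cball 0 k0|M. f k * h k)"

end

theory Submission
  imports Defs "HOL-Complex_Analysis.Complex_Analysis"
begin

text \<open>Along a ray w^2 y the Green's function is entire in w: the square absorbs the root of |y|,
  and Lam is entire. For a plane wave the damped integral can therefore be rotated from w > 0 to
  the ray arg w = pi/8, i.e. arg w^2 = pi/4, where exp(i |y|^2 / 4t) becomes a genuine Gaussian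
  that dominates every function of exponential type. By Fubini the rotation carries over to the
  superpositions F n. On the rotated ray dominated convergence removes the damping, and the
  resulting absolutely convergent integral represents Psi; it commutes with the integration in k
  and is continuous with respect to A1 convergence, locally uniformly in (t, x).\<close>

subsection \<open>Rotation of rays for entire functions\<close>

text \<open>At w = v cis \<beta> the damping decays at rate \<epsilon> cos(4\<beta>) and the
  oscillating factor of the Green's function at rate sin(4\<beta>)/(4t), both against v^4 |y|^2. At
  \<beta> = 0 only the damping decays; at \<beta> = pi/8 the cosine is 0 and the sine is 1, so the
  rate is 1/(4t) whatever \<epsilon> is. This singles out pi/8: bounds there do not see \<epsilon>,
  and the limit \<epsilon> -> 0 is harmless. \<open>Lam\<close> enters only through a crude bound by
  exp(2 |z|^2). The square of its argument is linear in |y|, so it contributes exponential growth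
  with constant 2 |x| / t, which the quadratic rate absorbs. Only plane waves are rotated directly.
  A superposition is split into plane waves by Fubini on the original ray with \<epsilon> > 0, and
  reassembled by Fubini on the rotated one.\<close>

lemma entire_primitive:
  assumes "f holomorphic_on UNIV"
  obtains P where "\<And>z. (P has_field_derivative f z) (at z)"
  using holomorphic_convex_primitive'[OF convex_UNIV open_UNIV assms] by auto

text \<open>The fundamental theorem on [0, R], where integrability lets R tend to infinity. It
  serves for rays from the origin and, with c = 1, for the horizontal rays in
  \<open>Lam_holomorphic\<close>.\<close>

lemma tendsto_ray_integral:
  fixes f P :: "complex \<Rightarrow> complex"
  assumes P: "\<And>z. (P has_field_derivative f z) (at z)"
    and cont: "continuous_on UNIV f"
    and int: "set_integrable lborel {0..} (\<lambda>v. c * f (z + of_real v * c))"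
  shows "((\<lambda>R. P (z + of_real R * c) - P z) \<longlongrightarrow> (LINT v:{0..}|lborel. c * f (z + of_real v * c))) at_top"
proof -
  have eq: "(LINT v|lborel. indicator {..R} v *\<^sub>R (indicator {0..} v *\<^sub>R (c * f (z + of_real v * c))))
      = P (z + of_real R * c) - P z" if "R \<ge> 0" for R
  proof -
    have "(LINT v|lborel. indicator {..R} v *\<^sub>R (indicator {0..} v *\<^sub>R (c * f (z + of_real v * c))))
       = (LINT v|lborel. indicator {0..R} v *\<^sub>R (c * f (z + of_real v * c)))"
      by (intro Bochner_Integration.integral_cong) (auto split: split_indicator)
    also have "\<dots> = P (z + of_real R * c) - P (z + of_real 0 * c)"
    proof (rule integral_FTC_atLeastAtMost[OF that])
      fix v :: real
      have "((\<lambda>v. z + of_real v * c) has_vector_derivative c) (at v)"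
        by (auto intro!: derivative_eq_intros)
      from field_vector_diff_chain_at[OF this P]
      show "((\<lambda>v. P (z + of_real v * c)) has_vector_derivative c * f (z + of_real v * c)) (at v within {0..R})"
        by (auto simp: o_def intro: has_vector_derivative_at_within)
    next
      show "continuous_on {0..R} (\<lambda>v. c * f (z + of_real v * c))"
        by (intro continuous_intros continuous_on_compose2[OF cont]) auto
    qed
    finally show ?thesis by simp
  qed
  have "((\<lambda>R. LINT v|lborel. indicator {..R} v *\<^sub>R (indicator {0..} v *\<^sub>R (c * f (z + of_real v * c))))
      \<longlongrightarrow> (LINT v:{0..}|lborel. c * f (z + of_real v * c))) at_top"
    unfolding set_lebesgue_integral_def
    by (rule tendsto_integral_at_top[OF _ int[unfolded set_integrable_def]]) simp
  then show ?thesis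
    by (rule Lim_transform_eventually)
       (use eventually_ge_at_top[of 0] in eventually_elim, rule eq)
qed

text \<open>Both integrals are limits of P(R cis \<beta>) - P(0) for a primitive P, at \<beta> =
  \<beta>0 and \<beta> = 0. The mean value inequality in the angle bounds their difference by
  \<beta>0 R g(R), which tends to 0. An entire primitive thus replaces a closed contour.\<close>

lemma rotate_ray_integral:
  fixes f :: "complex \<Rightarrow> complex"
  assumes hol: "f holomorphic_on UNIV" and "0 \<le> \<beta>0"
    and bound: "\<And>v \<beta>. v \<ge> 0 \<Longrightarrow> 0 \<le> \<beta> \<Longrightarrow> \<beta> \<le> \<beta>0 \<Longrightarrow> norm (f (of_real v * cis \<beta>)) \<le> g v"
    and lim: "((\<lambda>v. v * g v) \<longlongrightarrow> 0) at_top"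
    and int: "set_integrable lborel {0..} g"
  shows "(LINT v:{0..}|lborel. f (of_real v)) = (LINT v:{0..}|lborel. cis \<beta>0 * f (of_real v * cis \<beta>0))"
proof -
  obtain P where P: "\<And>z. (P has_field_derivative f z) (at z)"
    using entire_primitive[OF hol] by blast
  have cont: "continuous_on UNIV f" using hol by (rule holomorphic_on_imp_continuous_on)
  have meas: "f \<in> borel_measurable borel"
    using cont by (rule borel_measurable_continuous_onI)
  have intb: "set_integrable lborel {0..} (\<lambda>v. cis \<beta> * f (0 + of_real v * cis \<beta>))"
    if "0 \<le> \<beta>" "\<beta> \<le> \<beta>0" for \<beta>
  proof -
    have "set_borel_measurable borel {0..} (\<lambda>v. cis \<beta> * f (0 + of_real v * cis \<beta>))"
      unfolding set_borel_measurable_def using meas by measurable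
    then show ?thesis
      by (intro set_integrable_bound[OF int])
         (use bound that in \<open>auto simp: norm_mult set_borel_measurable_def intro: order_trans[OF _ abs_ge_self]\<close>)
  qed
  have L: "((\<lambda>R. P (of_real R * cis \<beta>) - P 0) \<longlongrightarrow> (LINT v:{0..}|lborel. cis \<beta> * f (of_real v * cis \<beta>))) at_top"
    if "0 \<le> \<beta>" "\<beta> \<le> \<beta>0" for \<beta>
    using tendsto_ray_integral[OF P cont intb[OF that]] by simp
  have arc: "norm (P (of_real R * cis \<beta>0) - P (of_real R * cis 0)) \<le> R * g R * norm (\<beta>0 - 0)" if "R \<ge> 0" for R
  proof (rule differentiable_bound[of "{0..\<beta>0}" "\<lambda>\<beta>. P (of_real R * cis \<beta>)"
        "\<lambda>\<beta>. \<lambda>h. h *\<^sub>R (of_real R * (\<i> * cis \<beta>) * f (of_real R * cis \<beta>))"])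
    fix \<beta> assume \<beta>: "\<beta> \<in> {0..\<beta>0}"
    have "((\<lambda>\<beta>. of_real R * cis \<beta>) has_vector_derivative of_real R * (\<i> * cis \<beta>)) (at \<beta>)"
      unfolding cis_conv_exp
      by (auto intro!: derivative_eq_intros has_vector_derivative_real_field)
    from field_vector_diff_chain_at[OF this P]
    show "((\<lambda>\<beta>. P (of_real R * cis \<beta>)) has_derivative
        (\<lambda>h. h *\<^sub>R (of_real R * (\<i> * cis \<beta>) * f (of_real R * cis \<beta>)))) (at \<beta> within {0..\<beta>0})"
      by (auto simp: o_def has_vector_derivative_def intro: has_derivative_at_withinI)
    show "onorm (\<lambda>h. h *\<^sub>R (of_real R * (\<i> * cis \<beta>) * f (of_real R * cis \<beta>))) \<le> R * g R"
      by (rule onorm_le) (use that \<beta> in \<open>auto simp: norm_mult mult.commute[of _ "\<bar>_\<bar>"] intro!: mult_left_mono bound\<close>)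
  qed (use \<open>0 \<le> \<beta>0\<close> in auto)
  have "((\<lambda>R. P (of_real R * cis \<beta>0) - P (of_real R * cis 0)) \<longlongrightarrow> 0) at_top"
  proof (rule Lim_null_comparison)
    show "((\<lambda>R. R * g R * norm (\<beta>0 - 0)) \<longlongrightarrow> 0) at_top"
      using tendsto_mult_left_zero[OF lim] by auto
  qed (use eventually_ge_at_top[of 0] in eventually_elim, rule arc)
  moreover have "((\<lambda>R. P (of_real R * cis \<beta>0) - P (of_real R * cis 0)) \<longlongrightarrow>
     (LINT v:{0..}|lborel. cis \<beta>0 * f (of_real v * cis \<beta>0)) - (LINT v:{0..}|lborel. cis 0 * f (of_real v * cis 0))) at_top"
    using tendsto_diff[OF L[of \<beta>0] L[of 0]] \<open>0 \<le> \<beta>0\<close> by simp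
  ultimately show ?thesis
    using tendsto_unique[OF trivial_limit_at_top_linorder] by fastforce
qed

subsection \<open>The function Lam\<close>

lemma set_integrable_exp_neg: "set_integrable lborel {0::real..} (\<lambda>s. exp (- s))"
  and set_integral_exp_neg: "(LINT s:{0..}|lborel. exp (- s)) = (1::real)"
proof -
  have "((\<lambda>s::real. - exp (- s)) \<longlongrightarrow> 0) at_top" by real_asymp
  then have "(\<integral>\<^sup>+s. ennreal (exp (- s)) * indicator {0..} s \<partial>lborel) = ennreal (0 - (- exp (- 0)))"
    by (intro nn_integral_FTC_atLeast[where F = "\<lambda>s. - exp (- s)"]) (auto intro!: derivative_eq_intros)
  then have "(\<integral>\<^sup>+s. ennreal (indicator {0..} s *\<^sub>R exp (- s)) \<partial>lborel) = ennreal 1"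
    by (simp add: ennreal_mult'' mult.commute ennreal_indicator)
  then have "has_bochner_integral lborel (\<lambda>s. indicator {0..} s *\<^sub>R exp (- s)) (1::real)"
    by (intro has_bochner_integral_nn_integral) auto
  then show "set_integrable lborel {0::real..} (\<lambda>s. exp (- s))"
    and "(LINT s:{0..}|lborel. exp (- s)) = (1::real)"
    by (auto simp: set_integrable_def set_lebesgue_integral_def has_bochner_integral_iff)
qed

definition Lam_integrand :: "complex \<Rightarrow> real \<Rightarrow> complex" where
  "Lam_integrand z s = exp (- (complex_of_real s)\<^sup>2 - 2 * z * complex_of_real s)"

text \<open>Completing the square in s after setting aside one factor exp(-s): the summand 1/2 pays
  for that factor, which supplies integrability.\<close>

lemma norm_Lam_integrand_le:
  assumes "s \<ge> 0"
  shows "norm (Lam_integrand z s) \<le> exp ((norm z + 1/2)\<^sup>2) * exp (- s)"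
proof -
  have "norm (Lam_integrand z s) = exp (- s\<^sup>2 - 2 * Re z * s)"
    by (simp add: Lam_integrand_def norm_exp_eq_Re flip: of_real_power)
  also have "\<dots> \<le> exp ((norm z + 1/2)\<^sup>2 + - s)"
  proof -
    have "- (Re z * s) \<le> norm z * s"
      using assms abs_Re_le_cmod[of z] by (metis abs_le_D2 mult_minus_left mult_right_mono)
    moreover have "0 \<le> (s - (norm z + 1/2))\<^sup>2" by simp
    ultimately show ?thesis by (simp add: power2_eq_square algebra_simps)
  qed
  finally show ?thesis by (simp only: exp_add)
qed

lemma set_integrable_Lam_integrand: "set_integrable lborel {0..} (Lam_integrand z)"
proof (rule set_integrable_bound)
  show "set_integrable lborel {0::real..} (\<lambda>s. exp ((norm z + 1/2)\<^sup>2) * exp (- s))"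
    using set_integrable_exp_neg by simp
  show "set_borel_measurable lborel {0..} (Lam_integrand z)"
    unfolding set_borel_measurable_def Lam_integrand_def by measurable
qed (use norm_Lam_integrand_le in auto)

text \<open>The exponent comes from (|z| + 1/2)^2 <= 2 |z|^2 + 1/2, the factor 4 from 2 / sqrt pi <=
  2 and exp(1/2) <= 2. What matters later is only that the exponent is quadratic in |z|.\<close>

lemma norm_Lam_le: "norm (Lam z) \<le> 4 * exp (2 * (norm z)\<^sup>2)"
proof -
  have "norm (LINT s:{0..}|lborel. Lam_integrand z s) \<le> (LINT s:{0..}|lborel. exp ((norm z + 1/2)\<^sup>2) * exp (- s))"
  proof -
    have "norm (LINT s:{0..}|lborel. Lam_integrand z s) \<le> (LINT s:{0..}|lborel. norm (Lam_integrand z s))"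
      by (rule set_integral_norm_bound[OF set_integrable_Lam_integrand])
    also have "\<dots> \<le> (LINT s:{0..}|lborel. exp ((norm z + 1/2)\<^sup>2) * exp (- s))"
      by (rule set_integral_mono)
         (use set_integrable_Lam_integrand set_integrable_exp_neg norm_Lam_integrand_le in \<open>auto intro: set_integrable_norm\<close>)
    finally show ?thesis .
  qed
  also have "\<dots> = exp ((norm z + 1/2)\<^sup>2)"
    by (simp add: set_integral_exp_neg)
  finally have 1: "norm (LINT s:{0..}|lborel. Lam_integrand z s) \<le> exp ((norm z + 1/2)\<^sup>2)" .
  have "(norm z + 1/2)\<^sup>2 \<le> 1/2 + 2 * (norm z)\<^sup>2"
  proof -
    have "0 \<le> (norm z - 1/2)\<^sup>2" by simp
    then show ?thesis by (simp add: power2_eq_square algebra_simps)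
  qed
  then have "exp ((norm z + 1/2)\<^sup>2) \<le> exp (1/2) * exp (2 * (norm z)\<^sup>2)"
    by (simp flip: exp_add)
  also have "exp (1/2::real) \<le> 2"
    using exp_bound_half[of "1/2::real"] by simp
  finally have 2: "exp ((norm z + 1/2)\<^sup>2) \<le> 2 * exp (2 * (norm z)\<^sup>2)" by simp
  have "sqrt pi \<ge> 1" using pi_ge_two by simp
  then have 3: "2 / sqrt pi \<le> 2" by (simp add: divide_le_eq)
  have "norm (Lam z) = 2 / sqrt pi * norm (LINT s:{0..}|lborel. Lam_integrand z s)"
    by (simp add: Lam_def Lam_integrand_def norm_mult norm_divide)
  also have "\<dots> \<le> 2 * (2 * exp (2 * (norm z)\<^sup>2))"
    by (rule mult_mono[OF 3 order_trans[OF 1 2]]) auto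
  finally show ?thesis by simp
qed

text \<open>With E a primitive of the Gaussian, completing the square turns Lam into
  exp(z^2) (const - E z), since E(z + R) and E(R) have the same limit as R tends to infinity.\<close>
lemma Lam_holomorphic: "Lam holomorphic_on UNIV"
proof -
  have hol: "(\<lambda>z::complex. exp (- z\<^sup>2)) holomorphic_on UNIV"
    by (auto intro!: holomorphic_intros)
  obtain E :: "complex \<Rightarrow> complex" where E: "\<And>z. (E has_field_derivative exp (- z\<^sup>2)) (at z)"
    using entire_primitive[OF hol] by blast
  have cont: "continuous_on UNIV (\<lambda>z::complex. exp (- z\<^sup>2))"
    by (intro continuous_intros)
  have sq: "exp (- (z + of_real v)\<^sup>2) = exp (- z\<^sup>2) * Lam_integrand z v" for z v
    by (simp add: Lam_integrand_def exp_add[symmetric] power2_eq_square algebra_simps)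
  have lim: "((\<lambda>R. E (z + of_real R) - E z) \<longlongrightarrow> exp (- z\<^sup>2) * (LINT v:{0..}|lborel. Lam_integrand z v)) at_top" for z
    using tendsto_ray_integral[OF E cont, of 1 z] set_integrable_Lam_integrand[of z] by (simp add: sq)
  define L where "L = (LINT v:{0..}|lborel. Lam_integrand 0 v) + E 0"
  have limL: "((\<lambda>R. E (of_real R)) \<longlongrightarrow> L) at_top"
    using tendsto_add[OF lim[of 0] tendsto_const[of "E 0"]] by (simp add: L_def)
  have diff: "((\<lambda>R. E (z + of_real R) - E (of_real R)) \<longlongrightarrow> 0) at_top" for z
  proof (rule Lim_null_comparison)
    \<comment> \<open>On the disc of radius |z| about R, |exp(-w^2)| = exp((Im w)^2 - (Re w)^2) is
      at most this exponential; the segment from R to z + R has length |z|.\<close>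
    show "((\<lambda>R. exp ((norm z)\<^sup>2 - (R - norm z)\<^sup>2) * norm z) \<longlongrightarrow> 0) at_top"
      by real_asymp
    have "norm (E (z + of_real R) - E (of_real R)) \<le> exp ((norm z)\<^sup>2 - (R - norm z)\<^sup>2) * norm (z + of_real R - of_real R)"
      if R: "R \<ge> norm z" for R
    proof (rule field_differentiable_bound[of "cball (of_real R) (norm z)" E "\<lambda>z. exp (- z\<^sup>2)"])
      fix w :: complex assume "w \<in> cball (of_real R) (norm z)"
      then have w: "norm (w - of_real R) \<le> norm z" by (simp add: dist_norm norm_minus_commute)
      have "\<bar>Im w\<bar> \<le> norm z" using abs_Im_le_cmod[of "w - of_real R"] w by simp
      then have 1: "(Im w)\<^sup>2 \<le> (norm z)\<^sup>2" by (simp add: abs_le_square_iff[symmetric])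
      have "Re w \<ge> R - norm z" using abs_Re_le_cmod[of "w - of_real R"] w by simp
      then have 2: "(R - norm z)\<^sup>2 \<le> (Re w)\<^sup>2" using R by (intro power_mono) auto
      show "norm (exp (- w\<^sup>2)) \<le> exp ((norm z)\<^sup>2 - (R - norm z)\<^sup>2)"
        using 1 2 by (simp add: norm_exp_eq_Re Re_power2)
    qed (auto simp: dist_norm intro: has_field_derivative_at_within E)
    then show "\<forall>\<^sub>F R in at_top. norm (E (z + of_real R) - E (of_real R)) \<le> exp ((norm z)\<^sup>2 - (R - norm z)\<^sup>2) * norm z"
      by (intro eventually_mono[OF eventually_ge_at_top[of "norm z"]]) simp
  qed
  have "((\<lambda>R. E (z + of_real R) - E z) \<longlongrightarrow> 0 + L - E z) at_top" for z
    using tendsto_diff[OF tendsto_add[OF diff limL] tendsto_const[of "E z"]] by simp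
  from tendsto_unique[OF trivial_limit_at_top_linorder lim this]
  have "exp (- z\<^sup>2) * (LINT v:{0..}|lborel. Lam_integrand z v) = L - E z" for z by simp
  then have int: "(LINT v:{0..}|lborel. Lam_integrand z v) = exp (z\<^sup>2) * (L - E z)" for z
    by (metis exp_minus_inverse mult.assoc mult_1 mult.commute)
  have Lam_eq: "Lam = (\<lambda>z. of_real (2 / sqrt pi) * (exp (z\<^sup>2) * (L - E z)))"
    by (rule ext) (simp add: Lam_def int[symmetric] Lam_integrand_def)
  have "E holomorphic_on UNIV"
    using E by (meson field_differentiable_at_within field_differentiable_def holomorphic_on_def)
  then show ?thesis
    unfolding Lam_eq by (intro holomorphic_intros)
qed

subsection \<open>Scaling in place of polar coordinates\<close>

lemma borel_measurable_fst_snd [measurable]: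
  "(fst :: 'a::second_countable_topology \<times> 'b::second_countable_topology \<Rightarrow> 'a) \<in> borel_measurable borel"
  "(snd :: 'a \<times> 'b \<Rightarrow> 'b) \<in> borel_measurable borel"
  by (auto intro!: borel_measurable_continuous_onI continuous_intros)

definition annulus :: "R2 set" where
  "annulus = {y. 1 \<le> norm y \<and> norm y \<le> 4}"

text \<open>The map y \<mapsto> w^2 y of the plane has Jacobian (w^2)^2 = w^4; with the weight 1/(w
  ln 2) this becomes w^3 / ln 2.\<close>

definition polar_density :: "R2 \<times> real \<Rightarrow> real" where
  "polar_density p = indicator annulus (fst p) * (indicator {0..} (snd p) * (snd p ^ 3 / ln 2))"

lemma annulus_measurable [measurable]: "annulus \<in> sets borel"
  unfolding annulus_def by measurable

lemma polar_density_measurable [measurable]: "polar_density \<in> borel_measurable borel"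
  unfolding polar_density_def by measurable

lemma polar_density_nonneg [simp]: "0 \<le> polar_density p"
  by (auto simp: polar_density_def split: split_indicator)

lemma nn_integral_lborel_scale:
  fixes f :: "'a::euclidean_space \<Rightarrow> ennreal"
  assumes [measurable]: "f \<in> borel_measurable borel" and "c > 0"
  shows "(\<integral>\<^sup>+y. f y \<partial>lborel) = (\<integral>\<^sup>+y. ennreal (c ^ DIM('a)) * f (c *\<^sub>R y) \<partial>lborel)"
proof -
  have "(\<integral>\<^sup>+y. f y \<partial>lborel) = (\<integral>\<^sup>+y. f y \<partial>density (distr lborel borel (\<lambda>x. 0 + c *\<^sub>R x)) (\<lambda>_. \<bar>c\<bar> ^ DIM('a)))"
    using lborel_affine[of c "0::'a"] \<open>c > 0\<close> by simp
  also have "\<dots> = (\<integral>\<^sup>+y. ennreal (c ^ DIM('a)) * f (c *\<^sub>R y) \<partial>lborel)"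
    using \<open>c > 0\<close> by (simp add: nn_integral_density nn_integral_distr ennreal_power)
  finally show ?thesis .
qed

text \<open>The admissible w form the interval from sqrt r / 2 to sqrt r, whose measure under dw/w
  is ln 2 for every r. The radii 1 and 4 of the annulus are what makes the end points differ by the
  factor 2.\<close>

lemma nn_integral_inverse_dyadic:
  assumes "r > 0"
  shows "(\<integral>\<^sup>+w. ennreal (indicator {0<..} w * indicator {w. 1 \<le> r / w\<^sup>2 \<and> r / w\<^sup>2 \<le> 4} w * (1 / (w * ln 2))) \<partial>lborel) = 1"
proof -
  have iff: "1 \<le> r / w\<^sup>2 \<and> r / w\<^sup>2 \<le> 4 \<longleftrightarrow> w \<in> {sqrt r / 2..sqrt r}" if "w > 0" for w
  proof -
    have "1 \<le> r / w\<^sup>2 \<longleftrightarrow> w \<le> sqrt r"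
      using that assms by (simp add: le_divide_eq) (metis abs_of_pos real_sqrt_abs real_sqrt_le_iff)
    moreover have "r / w\<^sup>2 \<le> 4 \<longleftrightarrow> sqrt r \<le> sqrt ((2 * w)\<^sup>2)"
      unfolding real_sqrt_le_iff using that by (simp add: divide_le_eq power_mult_distrib)
    moreover have "sqrt ((2 * w)\<^sup>2) = 2 * w" by (subst real_sqrt_abs) (use that in simp)
    ultimately have "1 \<le> r / w\<^sup>2 \<and> r / w\<^sup>2 \<le> 4 \<longleftrightarrow> w \<le> sqrt r \<and> sqrt r \<le> 2 * w" by metis
    then show ?thesis by auto
  qed
  have "(\<integral>\<^sup>+w. ennreal (indicator {0<..} w * indicator {w. 1 \<le> r / w\<^sup>2 \<and> r / w\<^sup>2 \<le> 4} w * (1 / (w * ln 2))) \<partial>lborel)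
    = (\<integral>\<^sup>+w. ennreal (1 / (w * ln 2)) * indicator {sqrt r / 2..sqrt r} w \<partial>lborel)"
  proof (intro nn_integral_cong)
    fix w :: real
    have "w > 0" if "w \<in> {sqrt r / 2..sqrt r}"
      using that assms by (auto intro: less_le_trans[of _ "sqrt r / 2"])
    then show "ennreal (indicator {0<..} w * indicator {w. 1 \<le> r / w\<^sup>2 \<and> r / w\<^sup>2 \<le> 4} w * (1 / (w * ln 2)))
       = ennreal (1 / (w * ln 2)) * indicator {sqrt r / 2..sqrt r} w"
      using iff[of w] by (auto simp: indicator_def)
  qed
  also have "\<dots> = ennreal (ln (sqrt r) / ln 2 - ln (sqrt r / 2) / ln 2)"
  proof (rule nn_integral_FTC_Icc)
    fix w assume "w \<in> {sqrt r / 2..sqrt r}"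
    then have w: "w > 0" using assms by (auto intro: less_le_trans[of _ "sqrt r / 2"])
    then show "((\<lambda>w. ln w / ln 2) has_real_derivative 1 / (w * ln 2)) (at w)"
      by (auto intro!: derivative_eq_intros simp: field_simps)
    show "0 \<le> 1 / (w * ln 2)" using w by simp
  qed (use assms in auto)
  also have "ln (sqrt r) / ln 2 - ln (sqrt r / 2) / ln 2 = 1"
    using assms by (simp add: ln_div field_simps)
  finally show ?thesis by simp
qed

text \<open>A substitute for polar coordinates that needs only scaling and Fubini: inserting
  1 = integral of 1[1 <= |y|/w^2 <= 4] dw / (w ln 2) and substituting w^2 y for y
  replaces the unit circle by an annulus. The square in w^2 makes sqrt |y| linear in w.\<close>
lemma nn_integral_polar:
  assumes [measurable]: "f \<in> borel_measurable borel"
  shows "(\<integral>\<^sup>+p. ennreal (polar_density p) * f ((snd p)\<^sup>2 *\<^sub>R fst p) \<partial>lborel) = (\<integral>\<^sup>+y. f y \<partial>lborel)"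
proof -
  define k where "k = (\<lambda>(y::R2) w::real. indicator {0<..} w * indicator {w. 1 \<le> norm y / w\<^sup>2 \<and> norm y / w\<^sup>2 \<le> 4} w * (1 / (w * ln 2)))"
  have [measurable (raw)]: "(\<lambda>x. k (g x) (h x)) \<in> borel_measurable M"
    if [measurable]: "g \<in> borel_measurable M" "h \<in> borel_measurable M" for g h and M :: "'m measure"
    unfolding k_def by measurable
  have scale: "(\<integral>\<^sup>+y. ennreal (polar_density (y, w)) * f (w\<^sup>2 *\<^sub>R y) \<partial>lborel) = (\<integral>\<^sup>+y. ennreal (k y w) * f y \<partial>lborel)" for w
  proof (cases "w > 0")
    case True
    have "(\<integral>\<^sup>+y. ennreal (k y w) * f y \<partial>lborel)
       = (\<integral>\<^sup>+y. ennreal ((w\<^sup>2) ^ DIM(R2)) * (ennreal (k (w\<^sup>2 *\<^sub>R y) w) * f (w\<^sup>2 *\<^sub>R y)) \<partial>lborel)"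
      by (rule nn_integral_lborel_scale) (use True in auto)
    also have "\<dots> = (\<integral>\<^sup>+y. ennreal (polar_density (y, w)) * f (w\<^sup>2 *\<^sub>R y) \<partial>lborel)"
    proof (intro nn_integral_cong)
      fix y :: R2
      have "(w\<^sup>2) ^ DIM(R2) * k (w\<^sup>2 *\<^sub>R y) w = polar_density (y, w)"
        using True by (simp add: k_def polar_density_def annulus_def indicator_def power_numeral_reduce)
      then have "ennreal (polar_density (y, w)) = ennreal ((w\<^sup>2) ^ DIM(R2)) * ennreal (k (w\<^sup>2 *\<^sub>R y) w)"
        by (subst ennreal_mult[symmetric]) (use True in \<open>auto simp: k_def\<close>)
      then show "ennreal ((w\<^sup>2) ^ DIM(R2)) * (ennreal (k (w\<^sup>2 *\<^sub>R y) w) * f (w\<^sup>2 *\<^sub>R y))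
          = ennreal (polar_density (y, w)) * f (w\<^sup>2 *\<^sub>R y)"
        by (simp add: mult.assoc)
    qed
    finally show ?thesis by simp
  next
    case False
    then have "polar_density (y, w) = 0" "k y w = 0" for y
      by (auto simp: polar_density_def k_def indicator_def)
    then show ?thesis by simp
  qed
  have "(\<integral>\<^sup>+p. ennreal (polar_density p) * f ((snd p)\<^sup>2 *\<^sub>R fst p) \<partial>lborel)
      = (\<integral>\<^sup>+w. (\<integral>\<^sup>+y. ennreal (polar_density (y, w)) * f (w\<^sup>2 *\<^sub>R y) \<partial>lborel) \<partial>lborel)"
    by (subst lborel_prod[symmetric], subst lborel_pair.nn_integral_snd[symmetric]) (simp_all add: lborel_prod)
  also have "\<dots> = (\<integral>\<^sup>+w. (\<integral>\<^sup>+y. ennreal (k y w) * f y \<partial>lborel) \<partial>lborel)"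
    by (simp add: scale)
  also have "\<dots> = (\<integral>\<^sup>+y. (\<integral>\<^sup>+w. ennreal (k y w) * f y \<partial>lborel) \<partial>lborel)"
    by (rule lborel_pair.Fubini') measurable
  also have "\<dots> = (\<integral>\<^sup>+y. f y \<partial>lborel)"
  proof (intro nn_integral_cong_AE)
    \<comment> \<open>At y = 0 the inserted factor integrates to 0 and not to 1, so the origin is
      discarded as a null set.\<close>
    show "AE y in lborel. (\<integral>\<^sup>+w. ennreal (k y w) * f y \<partial>lborel) = f y"
      using AE_lborel_singleton[of "0::R2"]
    proof eventually_elim
      case (elim y)
      have "(\<integral>\<^sup>+w. ennreal (k y w) * f y \<partial>lborel) = (\<integral>\<^sup>+w. ennreal (k y w) \<partial>lborel) * f y"
        by (rule nn_integral_multc) measurable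
      also have "(\<integral>\<^sup>+w. ennreal (k y w) \<partial>lborel) = 1"
        unfolding k_def using elim by (intro nn_integral_inverse_dyadic) simp
      finally show ?case by simp
    qed
  qed
  finally show ?thesis .
qed

text \<open>Tested on indicators, \<open>nn_integral_polar\<close> says that (y, w) \<mapsto> w^2 y
  pushes the measure with density \<open>polar_density\<close> forward to Lebesgue measure. The
  transfer also covers non-integrable f, where both sides are 0 by default.\<close>

lemma integral_polar:
  fixes f :: "R2 \<Rightarrow> complex"
  assumes [measurable]: "f \<in> borel_measurable borel"
  shows "(LINT y|lborel. f y) = (LINT p|lborel. polar_density p *\<^sub>R f ((snd p)\<^sup>2 *\<^sub>R fst p))"
proof -
  have [measurable]: "(\<lambda>p. (snd p)\<^sup>2 *\<^sub>R fst p) \<in> borel_measurable (borel :: (R2 \<times> real) measure)"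
    by measurable
  have "distr (density lborel polar_density) lborel (\<lambda>p. (snd p)\<^sup>2 *\<^sub>R fst p) = (lborel :: R2 measure)"
  proof (rule measure_eqI)
    fix X assume "X \<in> sets (distr (density lborel polar_density) lborel (\<lambda>p. (snd p)\<^sup>2 *\<^sub>R fst p :: R2))"
    then have [measurable]: "X \<in> sets borel" by simp
    have "emeasure (distr (density lborel polar_density) lborel (\<lambda>p. (snd p)\<^sup>2 *\<^sub>R fst p)) X
        = (\<integral>\<^sup>+p. ennreal (polar_density p) * indicator X ((snd p)\<^sup>2 *\<^sub>R fst p) \<partial>lborel)"
      by (subst nn_integral_indicator[symmetric])
         (simp_all add: nn_integral_distr nn_integral_density del: nn_integral_indicator)
    also have "\<dots> = emeasure lborel X"
      by (subst nn_integral_polar) simp_all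
    finally show "emeasure (distr (density lborel polar_density) lborel (\<lambda>p. (snd p)\<^sup>2 *\<^sub>R fst p)) X = emeasure lborel X" .
  qed simp
  then have "(LINT y|lborel. f y) = (LINT y|distr (density lborel polar_density) lborel (\<lambda>p. (snd p)\<^sup>2 *\<^sub>R fst p). f y)"
    by simp
  also have "\<dots> = (LINT p|density lborel polar_density. f ((snd p)\<^sup>2 *\<^sub>R fst p))"
    by (rule integral_distr) simp_all
  also have "\<dots> = (LINT p|lborel. polar_density p *\<^sub>R f ((snd p)\<^sup>2 *\<^sub>R fst p))"
    by (rule integral_density) simp_all
  finally show ?thesis .
qed

subsection \<open>The Green's function along rays\<close>

text \<open>An explicit form of \<open>ang\<close>, for which measurability and invariance under
  scaling are easy to see. The complex number is -i (y1 + i y2): the quarter turn carries the cut of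
  the plane to the nonpositive real axis, where \<open>Arg\<close> has its own cut, and pi/2 undoes
  the turn.\<close>

definition cut_arg :: "R2 \<Rightarrow> real" where
  "cut_arg y = Arg (Complex (snd y) (- fst y)) + pi / 2"

lemma cut_arg_scaleR: "u > 0 \<Longrightarrow> cut_arg (u *\<^sub>R y) = cut_arg y"
proof -
  assume "u > 0"
  have "Complex (u * snd y) (- (u * fst y)) = of_real u * Complex (snd y) (- fst y)"
    by (simp add: complex_eq_iff)
  then show ?thesis using \<open>u > 0\<close> by (simp add: cut_arg_def)
qed

lemma Omega_scaleR: "u > 0 \<Longrightarrow> u *\<^sub>R y \<in> Omega \<longleftrightarrow> y \<in> Omega"
  by (auto simp: Omega_def Gamma_cut_def mult_le_0_iff)

lemma Omega_measurable [measurable]: "Omega \<in> sets borel"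
  unfolding Omega_def Gamma_cut_def by measurable

lemma Arg_measurable [measurable]: "Arg \<in> borel_measurable borel"
proof -
  have [measurable]: "(\<lambda>z. if z \<in> - \<real>\<^sub>\<le>\<^sub>0 then Arg z else pi) \<in> borel_measurable borel"
    by (rule borel_measurable_continuous_on_if) (auto intro: continuous_on_Arg borel_open)
  have "Arg = (\<lambda>z. if z = 0 then 0 else if z \<in> - \<real>\<^sub>\<le>\<^sub>0 then Arg z else pi)"
  proof (rule ext)
    fix z show "Arg z = (if z = 0 then 0 else if z \<in> - \<real>\<^sub>\<le>\<^sub>0 then Arg z else pi)"
    proof (cases "z = 0")
      case False
      then have "Arg z = pi" if "z \<in> \<real>\<^sub>\<le>\<^sub>0"
        using that by (auto simp: Arg_eq_pi complex_nonpos_Reals_iff complex_eq_iff less_le)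
      with False show ?thesis by simp
    qed (simp add: Arg_zero)
  qed
  also have "\<dots> \<in> borel_measurable borel" by measurable
  finally show ?thesis .
qed

lemma ang_eq_cut_arg:
  assumes "y \<in> Omega"
  shows "ang y = cut_arg y"
proof -
  define z where "z = Complex (snd y) (- fst y)"
  have z: "z \<noteq> 0" using assms by (auto simp: z_def Omega_def Gamma_cut_def complex_eq_iff)
  have norm_z: "norm z = norm y"
    by (simp add: z_def cmod_def norm_prod_def add.commute)
  have Arg_z: "- pi < Arg z" "Arg z < pi"
    using Arg_bounded[of z] Arg_eq_pi[of z] assms
    by (auto simp: z_def Omega_def Gamma_cut_def less_le)
  have rc: "rcis (norm y) (Arg z) = z"
    using rcis_cmod_Arg[of z] norm_z by simp
  show ?thesis
    unfolding ang_def
  proof (rule the_equality)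
    have "norm y * cos (Arg z) = snd y" "norm y * sin (Arg z) = - fst y"
      using arg_cong[OF rc, of Re] arg_cong[OF rc, of Im] by (simp_all add: z_def)
    moreover have "cos (cut_arg y) = - sin (Arg z)" "sin (cut_arg y) = cos (Arg z)"
      by (simp_all add: cut_arg_def z_def[symmetric] cos_add sin_add)
    ultimately show "- pi / 2 < cut_arg y \<and> cut_arg y < 3 * pi / 2 \<and> y = (norm y * cos (cut_arg y), norm y * sin (cut_arg y))"
      using Arg_z by (auto simp: cut_arg_def z_def[symmetric] prod_eq_iff)
  next
    fix \<phi> assume \<phi>: "- pi / 2 < \<phi> \<and> \<phi> < 3 * pi / 2 \<and> y = (norm y * cos \<phi>, norm y * sin \<phi>)"
    then have yc: "fst y = norm y * cos \<phi>" "snd y = norm y * sin \<phi>"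
      by (metis fst_conv, metis snd_conv)
    have "z = rcis (norm y) (\<phi> - pi / 2)"
      using yc by (simp add: z_def complex_eq_iff cos_diff sin_diff)
    moreover have "norm y > 0" using z by (simp flip: norm_z)
    moreover have "\<phi> - pi / 2 \<in> {-pi<..pi}"
      using conjunct1[OF \<phi>] conjunct1[OF conjunct2[OF \<phi>]] by simp
    ultimately have "Arg z = \<phi> - pi / 2" by (intro Arg_unique'[of "norm y"])
    then show "\<phi> = cut_arg y" by (simp add: cut_arg_def z_def[symmetric])
  qed
qed

lemma holomorphic_on_Lam [holomorphic_intros]:
  "f holomorphic_on S \<Longrightarrow> (\<lambda>w. Lam (f w)) holomorphic_on S"
  using holomorphic_on_compose_gen[OF _ Lam_holomorphic, of f S] by (simp add: o_def)

lemma Lam_measurable [measurable]: "Lam \<in> borel_measurable borel"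
  by (intro borel_measurable_continuous_onI holomorphic_on_imp_continuous_on Lam_holomorphic)

text \<open>The damped Green's function at w^2 y, written for complex w. Norms continue
  holomorphically: |y| becomes w^2 |y|, its square w^4 |y|^2 and its root w sqrt |y|, without moduli
  of w; the angle of y is constant along the ray.\<close>

definition ray_green :: "bc \<Rightarrow> real \<Rightarrow> R2 \<Rightarrow> real \<Rightarrow> R2 \<Rightarrow> complex \<Rightarrow> complex" where
  "ray_green b t x \<epsilon> y w =
    exp (- complex_of_real \<epsilon> * w ^ 4 * complex_of_real ((norm y)\<^sup>2))
    * (exp (- (complex_of_real (norm x) + w\<^sup>2 * complex_of_real (norm y))\<^sup>2 / (4 * \<i> * complex_of_real t))
       / (8 * \<i> * complex_of_real pi * complex_of_real t)
     * (Lam (w * complex_of_real (sqrt (norm x * norm y) * cos ((cut_arg x - cut_arg y) / 2)) / csqrt (\<i> * complex_of_real t))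
        + bsign b * Lam (- (w * complex_of_real (sqrt (norm x * norm y) * sin ((cut_arg x + cut_arg y) / 2)) / csqrt (\<i> * complex_of_real t)))))"

lemma ray_green_eq:
  assumes "x \<in> Omega" "y \<in> Omega" "w > 0"
  shows "ray_green b t x \<epsilon> y (of_real w)
    = complex_of_real (exp (- \<epsilon> * (norm (w\<^sup>2 *\<^sub>R y))\<^sup>2)) * Green b t x (w\<^sup>2 *\<^sub>R y)"
proof -
  have "w\<^sup>2 *\<^sub>R y \<in> Omega" using assms by (simp add: Omega_scaleR)
  then have ang: "ang (w\<^sup>2 *\<^sub>R y) = cut_arg y" "ang x = cut_arg x"
    using assms by (simp_all add: ang_eq_cut_arg cut_arg_scaleR)
  have nrm: "norm (w\<^sup>2 *\<^sub>R y) = w\<^sup>2 * norm y" by simp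
  have sq: "sqrt (norm x * (w\<^sup>2 * norm y)) = w * sqrt (norm x * norm y)"
    using \<open>w > 0\<close> by (simp add: real_sqrt_mult)
  have reg: "exp (- complex_of_real \<epsilon> * complex_of_real w ^ 4 * complex_of_real ((norm y)\<^sup>2))
      = complex_of_real (exp (- \<epsilon> * (w\<^sup>2 * norm y)\<^sup>2))"
    by (simp add: power_mult_distrib mult.assoc flip: exp_of_real)
  show ?thesis
    unfolding ray_green_def Green_def Let_def ang nrm sq reg
    by (simp add: mult.assoc)
qed

lemma ray_green_holomorphic: "ray_green b t x \<epsilon> y holomorphic_on UNIV"
proof -
  have div: "(\<lambda>w. f w / c) holomorphic_on UNIV" if "f holomorphic_on UNIV" for f and c :: complex
    using that unfolding divide_inverse by (intro holomorphic_intros)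
  show ?thesis
    unfolding ray_green_def by (intro holomorphic_intros div)
qed

lemma cut_arg_measurable [measurable]: "cut_arg \<in> borel_measurable borel"
proof -
  have "(\<lambda>y. Complex (snd y) (- fst y)) \<in> borel_measurable borel"
    unfolding Complex_eq by measurable
  then show ?thesis unfolding cut_arg_def[abs_def] by measurable
qed

lemma ray_green_measurable [measurable (raw)]:
  assumes [measurable]: "f \<in> borel_measurable M" "g \<in> borel_measurable M"
  shows "(\<lambda>p. ray_green b t x \<epsilon> (f p) (g p)) \<in> borel_measurable M"
  unfolding ray_green_def by measurable

lemma norm_Lam_csqrt_le:
  assumes "t > 0" "\<bar>c\<bar> \<le> 1" "a \<ge> 0"
  shows "norm (Lam (w * complex_of_real (sqrt a * c) / csqrt (\<i> * complex_of_real t))) \<le> 4 * exp (2 * ((norm w)\<^sup>2 * a / t))"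
proof -
  have "(norm (csqrt (\<i> * complex_of_real t)))\<^sup>2 = t"
    using assms by (simp add: norm_mult flip: norm_power)
  then have "(norm (w * complex_of_real (sqrt a * c) / csqrt (\<i> * complex_of_real t)))\<^sup>2 = (norm w)\<^sup>2 * a / t * c\<^sup>2"
    using assms by (simp add: norm_divide norm_mult power_divide power_mult_distrib)
  also have "\<dots> \<le> (norm w)\<^sup>2 * a / t * 1"
    using assms by (intro mult_left_mono) (auto simp: abs_square_le_1)
  finally have "exp (2 * (norm (w * complex_of_real (sqrt a * c) / csqrt (\<i> * complex_of_real t)))\<^sup>2)
      \<le> exp (2 * ((norm w)\<^sup>2 * a / t))" by simp
  then show ?thesis
    using norm_Lam_le[of "w * complex_of_real (sqrt a * c) / csqrt (\<i> * complex_of_real t)"] by linarith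
qed

text \<open>The damping gives Re(w^4) = v^4 cos(4\<beta>), and the squared phase gives at least v^4
  sin(4\<beta>) / (4t), both times |y|^2. The two \<open>Lam\<close> terms cost exp(2 |x| |y| v^2 /
  t), of lower order in v^2 |y|.\<close>

lemma norm_ray_green_le:
  assumes "t > 0" "\<epsilon> \<ge> 0" "v \<ge> 0" "0 \<le> \<beta>" "\<beta> \<le> pi / 8"
  shows "norm (ray_green b t x \<epsilon> y (of_real v * cis \<beta>))
    \<le> 1 / t * exp (- (\<epsilon> * cos (4 * \<beta>) + sin (4 * \<beta>) / (4 * t)) * ((norm y)\<^sup>2 * v ^ 4) + 2 * norm x / t * (norm y * v\<^sup>2))"
proof -
  define r \<rho> where "r = norm x" and "\<rho> = norm y"
  have nn: "r \<ge> 0" "\<rho> \<ge> 0" by (auto simp: r_def \<rho>_def)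
  define w where "w = of_real v * cis \<beta>"
  have w2: "w\<^sup>2 = of_real (v\<^sup>2) * cis (2 * \<beta>)" and w4: "w ^ 4 = of_real (v ^ 4) * cis (4 * \<beta>)"
    by (simp_all add: w_def power_mult_distrib Complex.DeMoivre mult.commute)
  have norm_w: "norm w = v" using assms by (simp add: w_def norm_mult)
  have "norm (exp (- complex_of_real \<epsilon> * w ^ 4 * complex_of_real (\<rho>\<^sup>2))) = exp (- \<epsilon> * cos (4 * \<beta>) * (\<rho>\<^sup>2 * v ^ 4))"
    unfolding norm_exp_eq_Re w4 by (simp flip: of_real_power)
  moreover have "norm (exp (- (complex_of_real r + w\<^sup>2 * complex_of_real \<rho>)\<^sup>2 / (4 * \<i> * complex_of_real t)))
     \<le> exp (- sin (4 * \<beta>) / (4 * t) * (\<rho>\<^sup>2 * v ^ 4))"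
  proof -
    define X Y where "X = v\<^sup>2 * cos (2 * \<beta>)" and "Y = v\<^sup>2 * sin (2 * \<beta>)"
    have "2 * \<beta> \<le> pi" using assms pi_gt_zero by linarith
    then have Y: "Y \<ge> 0" using assms unfolding Y_def by (intro mult_nonneg_nonneg sin_ge_zero) auto
    have w2': "w\<^sup>2 = Complex X Y" by (simp add: w2 X_def Y_def complex_eq_iff)
    have "2 * (X * Y) = v ^ 4 * sin (4 * \<beta>)"
      using sin_double[of "2 * \<beta>"] by (simp add: X_def Y_def power_numeral_reduce mult_ac)
    moreover have "2 * ((r + X * \<rho>) * (Y * \<rho>)) = 2 * (X * Y) * \<rho>\<^sup>2 + 2 * (r * (Y * \<rho>))"
      by (simp add: algebra_simps power2_eq_square)
    \<comment> \<open>The cross term 2 r Y \<rho> is dropped: it is nonnegative because 2\<beta>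
      lies in [0, pi].\<close>
    ultimately have XY: "v ^ 4 * sin (4 * \<beta>) * \<rho>\<^sup>2 \<le> 2 * ((r + X * \<rho>) * (Y * \<rho>))"
      using nn Y by simp
    have "Re (- (complex_of_real r + w\<^sup>2 * complex_of_real \<rho>)\<^sup>2 / (4 * \<i> * complex_of_real t))
        = - (2 * ((r + X * \<rho>) * (Y * \<rho>))) / (4 * t)"
      unfolding w2' using assms by (simp add: Re_divide Im_divide power2_eq_square field_simps)
    also have "\<dots> \<le> - (v ^ 4 * sin (4 * \<beta>) * \<rho>\<^sup>2) / (4 * t)"
      using XY assms by (intro divide_right_mono) auto
    also have "\<dots> = - sin (4 * \<beta>) / (4 * t) * (\<rho>\<^sup>2 * v ^ 4)"
      by simp
    finally show ?thesis by (simp only: norm_exp_eq_Re exp_le_cancel_iff)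
  qed
  moreover have "norm (Lam (w * complex_of_real (sqrt (r * \<rho>) * cos ((cut_arg x - cut_arg y) / 2)) / csqrt (\<i> * complex_of_real t))
        + bsign b * Lam (- (w * complex_of_real (sqrt (r * \<rho>) * sin ((cut_arg x + cut_arg y) / 2)) / csqrt (\<i> * complex_of_real t))))
      \<le> 8 * exp (2 * r / t * (\<rho> * v\<^sup>2))" (is "norm (?L1 + _ * ?L2) \<le> _")
  proof -
    have "norm ?L1 \<le> 4 * exp (2 * (v\<^sup>2 * (r * \<rho>) / t))"
      using norm_Lam_csqrt_le[of t "cos ((cut_arg x - cut_arg y) / 2)" "r * \<rho>" w] assms nn by (simp add: norm_w)
    moreover have "norm ?L2 \<le> 4 * exp (2 * (v\<^sup>2 * (r * \<rho>) / t))"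
      using norm_Lam_csqrt_le[of t "- sin ((cut_arg x + cut_arg y) / 2)" "r * \<rho>" w] assms nn by (simp add: norm_w)
    moreover have "norm (?L1 + bsign b * ?L2) \<le> norm ?L1 + norm ?L2"
      by (rule order_trans[OF norm_triangle_ineq]) (simp add: norm_mult bsign_def split: bc.split)
    ultimately show ?thesis by (simp add: mult_ac)
  qed
  ultimately have "norm (ray_green b t x \<epsilon> y w) \<le> exp (- \<epsilon> * cos (4 * \<beta>) * (\<rho>\<^sup>2 * v ^ 4))
     * (exp (- sin (4 * \<beta>) / (4 * t) * (\<rho>\<^sup>2 * v ^ 4)) / (8 * pi * t) * (8 * exp (2 * r / t * (\<rho> * v\<^sup>2))))"
    unfolding ray_green_def r_def[symmetric] \<rho>_def[symmetric] norm_mult norm_divide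
    using assms by (intro mult_mono divide_mono) (auto simp: norm_mult)
  also have "\<dots> = 1 / (pi * t) * exp (- \<epsilon> * cos (4 * \<beta>) * (\<rho>\<^sup>2 * v ^ 4)
     + - sin (4 * \<beta>) / (4 * t) * (\<rho>\<^sup>2 * v ^ 4) + 2 * r / t * (\<rho> * v\<^sup>2))"
    unfolding exp_add by simp
  also have "\<dots> \<le> 1 / t * exp (- \<epsilon> * cos (4 * \<beta>) * (\<rho>\<^sup>2 * v ^ 4)
     + - sin (4 * \<beta>) / (4 * t) * (\<rho>\<^sup>2 * v ^ 4) + 2 * r / t * (\<rho> * v\<^sup>2))"
    using assms pi_ge_two by (intro mult_right_mono divide_left_mono) auto
  finally show ?thesis
    by (simp add: w_def r_def \<rho>_def algebra_simps)
qed

subsection \<open>Absolute convergence on the rotated ray\<close>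

lemma integrable_mult_pair:
  fixes f :: "'a \<Rightarrow> real" and g :: "'b \<Rightarrow> real"
  assumes "sigma_finite_measure M" "sigma_finite_measure N"
    and f: "integrable M f" and g: "integrable N g"
  shows "integrable (M \<Otimes>\<^sub>M N) (\<lambda>p. f (fst p) * g (snd p))"
proof -
  interpret pair_sigma_finite M N using assms(1,2) by (rule pair_sigma_finite.intro)
  note [measurable] = borel_measurable_integrable[OF f] borel_measurable_integrable[OF g]
  show ?thesis
  proof (rule Fubini_integrable)
    show "(\<lambda>p. f (fst p) * g (snd p)) \<in> borel_measurable (M \<Otimes>\<^sub>M N)" by measurable
    show "integrable M (\<lambda>x. \<integral>y. norm (f (fst (x, y)) * g (snd (x, y))) \<partial>N)"
      using f g by (simp add: abs_mult)
    show "AE x in M. integrable N (\<lambda>y. f (fst (x, y)) * g (snd (x, y)))"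
      using g by simp
  qed
qed

text \<open>Half of the quartic absorbs the quadratic term, c v^2 <= c^2 / (2\<kappa>) +
  (\<kappa>/2) v^4. The other half is integrated explicitly, since v^3 is up to a constant the
  derivative of v^4.\<close>

lemma set_integrable_cubic_exp_quartic:
  fixes \<kappa> c :: real
  assumes "\<kappa> > 0"
  shows "set_integrable lborel {0..} (\<lambda>v. v ^ 3 * exp (- \<kappa> * v ^ 4 + c * v\<^sup>2))"
proof -
  have "set_integrable lborel {0..} (\<lambda>v. v ^ 3 * exp (- (\<kappa> / 2) * v ^ 4))"
  proof -
    have "((\<lambda>v. - exp (- (\<kappa> / 2) * v ^ 4) / (2 * \<kappa>)) \<longlongrightarrow> 0) at_top"
      using assms by real_asymp
    then have "(\<integral>\<^sup>+v. ennreal (v ^ 3 * exp (- (\<kappa> / 2) * v ^ 4)) * indicator {0..} v \<partial>lborel)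
        = ennreal (0 - - exp (- (\<kappa> / 2) * 0 ^ 4) / (2 * \<kappa>))"
      using assms by (intro nn_integral_FTC_atLeast) (auto intro!: derivative_eq_intros)
    moreover have "ennreal (norm (indicator {0..} v *\<^sub>R (v ^ 3 * exp (- (\<kappa> / 2) * v ^ 4))))
        = ennreal (v ^ 3 * exp (- (\<kappa> / 2) * v ^ 4)) * indicator {0..} v" for v :: real
      by (simp split: split_indicator)
    ultimately show ?thesis
      unfolding set_integrable_def by (intro integrableI_bounded) auto
  qed
  then have "set_integrable lborel {0..} (\<lambda>v. exp (c\<^sup>2 / (2 * \<kappa>)) * (v ^ 3 * exp (- (\<kappa> / 2) * v ^ 4)))"
    by simp
  then show ?thesis
  proof (rule set_integrable_bound)
    show "set_borel_measurable lborel {0..} (\<lambda>v. v ^ 3 * exp (- \<kappa> * v ^ 4 + c * v\<^sup>2))"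
      unfolding set_borel_measurable_def by measurable
    have "v ^ 3 * exp (- \<kappa> * v ^ 4 + c * v\<^sup>2) \<le> exp (c\<^sup>2 / (2 * \<kappa>)) * (v ^ 3 * exp (- (\<kappa> / 2) * v ^ 4))"
      if "v \<ge> 0" for v
    proof -
      have "0 \<le> (\<kappa> * v\<^sup>2 - c)\<^sup>2 / (2 * \<kappa>)" using assms by simp
      also have "\<dots> = c\<^sup>2 / (2 * \<kappa>) - (\<kappa> / 2) * v ^ 4 - (- \<kappa> * v ^ 4 + c * v\<^sup>2)"
        using assms by (simp add: field_simps power_numeral_reduce)
      finally have "exp (- \<kappa> * v ^ 4 + c * v\<^sup>2) \<le> exp (c\<^sup>2 / (2 * \<kappa>) + - (\<kappa> / 2) * v ^ 4)"
        by simp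
      from mult_left_mono[OF this, of "v ^ 3"] that show ?thesis
        by (simp only: exp_add) (simp add: mult_ac)
    qed
    then show "AE v in lborel. v \<in> {0..} \<longrightarrow> norm (v ^ 3 * exp (- \<kappa> * v ^ 4 + c * v\<^sup>2))
        \<le> norm (exp (c\<^sup>2 / (2 * \<kappa>)) * (v ^ 3 * exp (- (\<kappa> / 2) * v ^ 4)))"
      using assms by (auto intro!: AE_I2)
  qed
qed

text \<open>Here \<kappa> is a decay rate and c an exponential growth constant. On the annulus |y|
  >= 1 allows |y|^2 to be omitted next to \<kappa>, and |y| <= 4 gives the factor 4 of c, so the
  exponential depends on w alone.\<close>

definition majorant :: "real \<Rightarrow> real \<Rightarrow> R2 \<times> real \<Rightarrow> real" where
  "majorant \<kappa> c p = polar_density p * exp (- \<kappa> * snd p ^ 4 + 4 * c * (snd p)\<^sup>2)"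

lemma majorant_nonneg [simp]: "0 \<le> majorant \<kappa> c p"
  by (simp add: majorant_def)

lemma integrable_majorant:
  assumes "\<kappa> > 0"
  shows "integrable lborel (majorant \<kappa> c)"
proof -
  have "emeasure lborel annulus < \<infinity>"
    by (rule emeasure_bounded_finite) (auto simp: annulus_def intro: boundedI)
  then have "integrable lborel (indicator annulus :: R2 \<Rightarrow> real)"
    by (intro integrable_real_indicator) auto
  moreover have "integrable lborel (\<lambda>v. indicator {0..} v *\<^sub>R (v ^ 3 * exp (- \<kappa> * v ^ 4 + 4 * c * v\<^sup>2)) / ln 2)"
    using set_integrable_cubic_exp_quartic[OF assms, of "4 * c"] unfolding set_integrable_def by simp
  ultimately have "integrable (lborel \<Otimes>\<^sub>M lborel) (\<lambda>p. indicator annulus (fst p :: R2)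
      * (indicator {0..} (snd p) *\<^sub>R (snd p ^ 3 * exp (- \<kappa> * snd p ^ 4 + 4 * c * (snd p)\<^sup>2)) / ln 2))"
    by (intro integrable_mult_pair sigma_finite_lborel)
  then show ?thesis
    unfolding lborel_prod majorant_def[abs_def] polar_density_def by (simp add: mult_ac)
qed

lemma majorant_mono:
  assumes "\<kappa>' \<le> \<kappa>" "c \<le> c'"
  shows "majorant \<kappa> c p \<le> majorant \<kappa>' c' p"
  unfolding majorant_def
proof (intro mult_left_mono exp_le_cancel_iff[THEN iffD2] add_mono mult_right_mono)
qed (use assms in auto)

text \<open>\<open>cis \<beta> ^ 4\<close> is the phase of w^3 dw at w = v cis \<beta>; the modulus
  v^3 dv is already in \<open>polar_density\<close>.\<close>

definition ray_kernel :: "bc \<Rightarrow> real \<Rightarrow> R2 \<Rightarrow> real \<Rightarrow> real \<Rightarrow> R2 \<times> real \<Rightarrow> complex" where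
  "ray_kernel b t x \<beta> \<epsilon> p = (polar_density p * indicator Omega (fst p)) *\<^sub>R
     (cis \<beta> ^ 4 * ray_green b t x \<epsilon> (fst p) (of_real (snd p) * cis \<beta>))"

definition ray_point :: "real \<Rightarrow> R2 \<times> real \<Rightarrow> C2" where
  "ray_point \<beta> p = ((of_real (snd p) * cis \<beta>)\<^sup>2 * of_real (fst (fst p)), (of_real (snd p) * cis \<beta>)\<^sup>2 * of_real (snd (fst p)))"

definition ray_psi :: "bc \<Rightarrow> real \<Rightarrow> R2 \<Rightarrow> real \<Rightarrow> real \<Rightarrow> (C2 \<Rightarrow> complex) \<Rightarrow> complex" where
  "ray_psi b t x \<beta> \<epsilon> F = (LINT p|lborel. ray_kernel b t x \<beta> \<epsilon> p * F (ray_point \<beta> p))"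

lemma ray_kernel_measurable [measurable]: "ray_kernel b t x \<beta> \<epsilon> \<in> borel_measurable borel"
  unfolding ray_kernel_def by measurable

lemma ray_point_measurable [measurable]: "ray_point \<beta> \<in> borel_measurable borel"
  unfolding ray_point_def by measurable

lemma norm_ray_point: "norm (ray_point \<beta> p) = norm (fst p) * (snd p)\<^sup>2"
proof -
  define q where "q = (of_real (snd p) * cis \<beta>)\<^sup>2"
  have q: "norm q = (snd p)\<^sup>2" by (simp add: q_def norm_mult norm_power)
  have "(norm (ray_point \<beta> p))\<^sup>2 = (norm q)\<^sup>2 * ((fst (fst p))\<^sup>2 + (snd (fst p))\<^sup>2)"
    unfolding ray_point_def q_def[symmetric]
    by (simp add: norm_Pair norm_mult power_mult_distrib algebra_simps)
  also have "\<dots> = (norm (fst p) * (snd p)\<^sup>2)\<^sup>2"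
    by (simp add: q norm_prod_def power_mult_distrib)
  finally show ?thesis by (simp add: power2_eq_iff_nonneg)
qed

lemma norm_ray_kernel_le:
  assumes "t > 0" "\<epsilon> \<ge> 0" "0 \<le> \<beta>" "\<beta> \<le> pi / 8"
    and \<kappa>: "0 < \<kappa>" "\<kappa> \<le> \<epsilon> * cos (4 * \<beta>) + sin (4 * \<beta>) / (4 * t)"
  shows "norm (ray_kernel b t x \<beta> \<epsilon> p) \<le> 1 / t * majorant \<kappa> (2 * norm x / t) p"
proof (cases "fst p \<in> annulus \<and> snd p \<ge> 0")
  case False
  then have "polar_density p = 0" by (auto simp: polar_density_def)
  then show ?thesis by (simp add: ray_kernel_def majorant_def)
next
  case True
  define \<rho> v where "\<rho> = norm (fst p)" and "v = snd p"
  have \<rho>: "1 \<le> \<rho>" "\<rho> \<le> 4" and v: "v \<ge> 0" using True by (auto simp: \<rho>_def v_def annulus_def)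
  define K where "K = \<epsilon> * cos (4 * \<beta>) + sin (4 * \<beta>) / (4 * t)"
  have "\<kappa> * v ^ 4 \<le> K * (\<rho>\<^sup>2 * v ^ 4)"
  proof (rule mult_mono)
    show "v ^ 4 \<le> \<rho>\<^sup>2 * v ^ 4" using \<rho> v by (simp add: mult_le_cancel_right1 one_le_power)
  qed (use \<kappa> v in \<open>auto simp: K_def\<close>)
  moreover have "2 * norm x / t * (\<rho> * v\<^sup>2) \<le> 2 * norm x / t * (4 * v\<^sup>2)"
    using \<rho> assms by (intro mult_left_mono mult_right_mono) auto
  ultimately have e: "exp (- K * (\<rho>\<^sup>2 * v ^ 4) + 2 * norm x / t * (\<rho> * v\<^sup>2)) \<le> exp (- \<kappa> * v ^ 4 + 4 * (2 * norm x / t) * v\<^sup>2)"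
    by simp
  have "norm (ray_kernel b t x \<beta> \<epsilon> p) \<le> polar_density p * norm (ray_green b t x \<epsilon> (fst p) (of_real v * cis \<beta>))"
    by (auto simp: ray_kernel_def norm_mult norm_power v_def abs_mult split: split_indicator)
  also have "\<dots> \<le> polar_density p * (1 / t * exp (- K * (\<rho>\<^sup>2 * v ^ 4) + 2 * norm x / t * (\<rho> * v\<^sup>2)))"
    unfolding \<rho>_def K_def by (intro mult_left_mono norm_ray_green_le) (use assms v in auto)
  also have "\<dots> \<le> polar_density p * (1 / t * exp (- \<kappa> * v ^ 4 + 4 * (2 * norm x / t) * v\<^sup>2))"
    using e assms by (intro mult_left_mono) auto
  finally show ?thesis by (simp add: majorant_def v_def)
qed

text \<open>On the annulus |\<open>ray_point \<beta> p\<close>| = |y| v^2 <= 4 v^2, so the growth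
  constant B of F simply adds to the 2 |x| / t of the kernel.\<close>

lemma norm_ray_integrand_le:
  assumes "t > 0" "\<epsilon> \<ge> 0" "0 \<le> \<beta>" "\<beta> \<le> pi / 8"
    and \<kappa>: "0 < \<kappa>" "\<kappa> \<le> \<epsilon> * cos (4 * \<beta>) + sin (4 * \<beta>) / (4 * t)"
    and F: "norm (F (ray_point \<beta> p)) \<le> A * exp (B * norm (ray_point \<beta> p))" and "B \<ge> 0"
  shows "norm (ray_kernel b t x \<beta> \<epsilon> p * F (ray_point \<beta> p)) \<le> A / t * majorant \<kappa> (2 * norm x / t + B) p"
proof (cases "fst p \<in> annulus")
  case False
  then have "polar_density p = 0" by (auto simp: polar_density_def)
  then show ?thesis by (simp add: ray_kernel_def majorant_def)
next
  case True
  have "0 \<le> A * exp (B * norm (ray_point \<beta> p))" using F norm_ge_zero order_trans by blast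
  then have A: "A \<ge> 0" by (simp add: zero_le_mult_iff)
  have "B * norm (ray_point \<beta> p) \<le> B * (4 * (snd p)\<^sup>2)"
    using True \<open>B \<ge> 0\<close> unfolding norm_ray_point by (intro mult_left_mono mult_right_mono) (auto simp: annulus_def)
  then have "A * exp (B * norm (ray_point \<beta> p)) \<le> A * exp (B * (4 * (snd p)\<^sup>2))"
    using A by (intro mult_left_mono) auto
  with F have F': "norm (F (ray_point \<beta> p)) \<le> A * exp (B * (4 * (snd p)\<^sup>2))" by linarith
  have "norm (ray_kernel b t x \<beta> \<epsilon> p * F (ray_point \<beta> p))
      \<le> (1 / t * majorant \<kappa> (2 * norm x / t) p) * (A * exp (B * (4 * (snd p)\<^sup>2)))"
    unfolding norm_mult by (intro mult_mono norm_ray_kernel_le F') (use assms in auto)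
  also have "\<dots> = A / t * majorant \<kappa> (2 * norm x / t + B) p"
  proof -
    have "exp (- \<kappa> * snd p ^ 4 + 4 * (2 * norm x / t + B) * (snd p)\<^sup>2)
        = exp (- \<kappa> * snd p ^ 4 + 4 * (2 * norm x / t) * (snd p)\<^sup>2) * exp (B * (4 * (snd p)\<^sup>2))"
      by (simp add: algebra_simps flip: exp_add)
    then show ?thesis by (simp add: majorant_def)
  qed
  finally show ?thesis .
qed

section \<open>Plane waves: rotation of the planar integral and superposition\<close>

lemma norm_pw_le: "norm (pw k z) \<le> exp (norm k * norm z)"
proof -
  have "norm (pw k z) \<le> exp (norm (complex_of_real (fst k) * fst z + complex_of_real (snd k) * snd z))"
    using norm_exp[of "\<i> * (complex_of_real (fst k) * fst z + complex_of_real (snd k) * snd z)"]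
    by (simp add: pw_def norm_mult)
  also have "norm (complex_of_real (fst k) * fst z + complex_of_real (snd k) * snd z)
      \<le> norm (\<bar>fst k\<bar>, \<bar>snd k\<bar>) * norm (norm (fst z), norm (snd z))"
  proof -
    have "norm (complex_of_real (fst k) * fst z + complex_of_real (snd k) * snd z)
      \<le> \<bar>fst k\<bar> * norm (fst z) + \<bar>snd k\<bar> * norm (snd z)"
      by (rule order_trans[OF norm_triangle_ineq]) (simp add: norm_mult)
    also have "\<dots> = inner (\<bar>fst k\<bar>, \<bar>snd k\<bar>) (norm (fst z), norm (snd z))" by simp
    also have "\<dots> \<le> norm (\<bar>fst k\<bar>, \<bar>snd k\<bar>) * norm (norm (fst z), norm (snd z))"
      by (rule norm_cauchy_schwarz)
    finally show ?thesis .
  qed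
  also have "\<dots> = norm k * norm z" by (simp add: norm_prod_def)
  finally show ?thesis by simp
qed

lemma pw_measurable [measurable (raw)]:
  assumes [measurable]: "f \<in> borel_measurable M" "g \<in> borel_measurable M"
  shows "(\<lambda>p. pw (f p) (g p)) \<in> borel_measurable M"
  unfolding pw_def by measurable

text \<open>For 4\<beta> in [0, pi/2] both functions lie in [0, 1], so cos + sin >= cos^2 + sin^2 =
  1. With \<delta> = 1/(4t) this yields one positive decay rate for the whole sector, as the
  rotation requires; it needs \<epsilon> > 0.\<close>

lemma min_le_sector_rate:
  assumes "\<epsilon> \<ge> 0" "\<delta> \<ge> 0" "0 \<le> \<beta>" "\<beta> \<le> pi / 8"
  shows "min \<epsilon> \<delta> \<le> \<epsilon> * cos (4 * \<beta>) + \<delta> * sin (4 * \<beta>)"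
proof -
  have c: "0 \<le> cos (4 * \<beta>)" and s: "0 \<le> sin (4 * \<beta>)"
    using assms by (auto intro!: cos_ge_zero sin_ge_zero)
  have "(cos (4 * \<beta>))\<^sup>2 \<le> cos (4 * \<beta>)" "(sin (4 * \<beta>))\<^sup>2 \<le> sin (4 * \<beta>)"
    using c s by (simp_all add: power2_eq_square mult_left_le)
  then have "1 \<le> cos (4 * \<beta>) + sin (4 * \<beta>)"
    using sin_cos_squared_add[of "4 * \<beta>"] by linarith
  then have "min \<epsilon> \<delta> * 1 \<le> min \<epsilon> \<delta> * (cos (4 * \<beta>) + sin (4 * \<beta>))"
    using assms by (intro mult_left_mono) auto
  also have "\<dots> \<le> \<epsilon> * cos (4 * \<beta>) + \<delta> * sin (4 * \<beta>)"
    unfolding distrib_left using c s by (intro add_mono mult_right_mono) auto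
  finally show ?thesis by simp
qed

lemma integrable_ray_integrand:
  assumes "t > 0" "\<epsilon> \<ge> 0" "0 \<le> \<beta>" "\<beta> \<le> pi / 8"
    and \<kappa>: "0 < \<kappa>" "\<kappa> \<le> \<epsilon> * cos (4 * \<beta>) + sin (4 * \<beta>) / (4 * t)"
    and [measurable]: "F \<in> borel_measurable borel"
    and F: "\<And>z. norm (F z) \<le> A * exp (B * norm z)" and "B \<ge> 0"
  shows "integrable lborel (\<lambda>p. ray_kernel b t x \<beta> \<epsilon> p * F (ray_point \<beta> p))"
proof (rule Bochner_Integration.integrable_bound)
  show "integrable lborel (\<lambda>p. A / t * majorant \<kappa> (2 * norm x / t + B) p)"
    using integrable_majorant[OF \<kappa>(1)] by simp
  show "AE p in lborel. norm (ray_kernel b t x \<beta> \<epsilon> p * F (ray_point \<beta> p))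
      \<le> norm (A / t * majorant \<kappa> (2 * norm x / t + B) p)"
    using norm_ray_integrand_le[OF assms(1-6), of F] F \<open>B \<ge> 0\<close>
    by (intro AE_I2) (metis abs_ge_self order_trans real_norm_def)
qed measurable

text \<open>Absolute convergence at both angles lets Fubini make the scale w the inner variable. For
  fixed y in the annulus the inner integral is then rotated in one complex variable.\<close>

lemma ray_psi_rotate:
  assumes "t > 0" "\<epsilon> > 0"
  shows "ray_psi b t x 0 \<epsilon> (pw k) = ray_psi b t x (pi / 8) \<epsilon> (pw k)"
proof -
  define \<kappa> where "\<kappa> = min \<epsilon> (1 / (4 * t))"
  have \<kappa>: "0 < \<kappa>" using assms by (simp add: \<kappa>_def)
  have \<kappa>_le: "\<kappa> \<le> \<epsilon> * cos (4 * \<beta>) + sin (4 * \<beta>) / (4 * t)" if "0 \<le> \<beta>" "\<beta> \<le> pi / 8" for \<beta>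
    using min_le_sector_rate[of \<epsilon> "1 / (4 * t)" \<beta>] that assms by (simp add: \<kappa>_def)
  \<comment> \<open>The Jacobian factor w^3 joins the holomorphic integrand. It accounts for three
    of the four factors \<open>cis \<beta>\<close> in the kernel; the remaining one belongs to
    dw.\<close>
  define f where "f y w = w ^ 3 * (ray_green b t x \<epsilon> y w * pw k (w\<^sup>2 * of_real (fst y), w\<^sup>2 * of_real (snd y)))" for y w
  define d where "d = (\<lambda>y::R2. indicator annulus y * indicator Omega y / ln 2 :: real)"
  have integrand: "ray_kernel b t x \<beta> \<epsilon> (y, v) * pw k (ray_point \<beta> (y, v))
      = d y *\<^sub>R (indicator {0..} v *\<^sub>R (cis \<beta> * f y (of_real v * cis \<beta>)))" for y v \<beta>
    by (simp add: ray_kernel_def ray_point_def f_def d_def polar_density_def scaleR_conv_of_real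
        power_mult_distrib power_numeral_reduce)
  have iter: "ray_psi b t x \<beta> \<epsilon> (pw k) = (LINT y|lborel. d y *\<^sub>R (LINT v:{0..}|lborel. cis \<beta> * f y (of_real v * cis \<beta>)))"
    if \<beta>: "0 \<le> \<beta>" "\<beta> \<le> pi / 8" for \<beta>
  proof -
    have "integrable lborel (\<lambda>p. ray_kernel b t x \<beta> \<epsilon> p * pw k (ray_point \<beta> p))"
      using assms by (intro integrable_ray_integrand[OF _ _ \<beta> \<kappa> \<kappa>_le[OF \<beta>], where A = 1 and B = "norm k"])
        (auto intro: norm_pw_le)
    then have "integrable (lborel \<Otimes>\<^sub>M lborel) (\<lambda>p. ray_kernel b t x \<beta> \<epsilon> p * pw k (ray_point \<beta> p))"
      by (simp add: lborel_prod)
    from lborel_pair.integral_fst'[OF this]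
    have "ray_psi b t x \<beta> \<epsilon> (pw k) = (LINT y|lborel. LINT v|lborel. ray_kernel b t x \<beta> \<epsilon> (y, v) * pw k (ray_point \<beta> (y, v)))"
      by (simp add: ray_psi_def lborel_prod)
    then show ?thesis
      by (simp only: integrand integral_scaleR_right set_lebesgue_integral_def)
  qed
  have rot: "(LINT v:{0..}|lborel. f y (of_real v)) = (LINT v:{0..}|lborel. cis (pi / 8) * f y (of_real v * cis (pi / 8)))"
    if y: "y \<in> annulus" "y \<in> Omega" for y
  proof (rule rotate_ray_integral)
    let ?c = "2 * norm x / t + norm k"
    have "(\<lambda>w. pw k (w\<^sup>2 * of_real (fst y), w\<^sup>2 * of_real (snd y))) holomorphic_on UNIV"
      unfolding pw_def by (auto intro!: holomorphic_intros)
    then show "f y holomorphic_on UNIV"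
      unfolding f_def[abs_def] by (intro holomorphic_intros ray_green_holomorphic)
    show "norm (f y (of_real v * cis \<beta>)) \<le> 1 / t * (v ^ 3 * exp (- \<kappa> * v ^ 4 + 4 * ?c * v\<^sup>2))"
      if v: "0 \<le> v" and \<beta>: "0 \<le> \<beta>" "\<beta> \<le> pi / 8" for v \<beta>
    proof -
      \<comment> \<open>The one-dimensional bound is read off from the planar majorant at (y, v), by
        cancelling the common weight 1 / ln 2.\<close>
      have "norm (ray_kernel b t x \<beta> \<epsilon> (y, v) * pw k (ray_point \<beta> (y, v))) \<le> 1 / t * majorant \<kappa> ?c (y, v)"
        using assms by (intro norm_ray_integrand_le[OF _ _ \<beta> \<kappa> \<kappa>_le[OF \<beta>]]) (auto intro: norm_pw_le)
      moreover have "majorant \<kappa> ?c (y, v) = v ^ 3 * exp (- \<kappa> * v ^ 4 + 4 * ?c * v\<^sup>2) / ln 2"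
        using y v by (simp add: majorant_def polar_density_def)
      moreover have "norm (d y *\<^sub>R (indicator {0..} v *\<^sub>R (cis \<beta> * f y (of_real v * cis \<beta>))))
          = norm (f y (of_real v * cis \<beta>)) / ln 2"
        using y v by (simp add: d_def norm_mult)
      ultimately have "norm (f y (of_real v * cis \<beta>)) / ln 2
          \<le> (1 / t * (v ^ 3 * exp (- \<kappa> * v ^ 4 + 4 * ?c * v\<^sup>2))) / ln 2"
        by (simp only: integrand times_divide_eq_right)
      then show ?thesis
        by (rule divide_le_cancel[THEN iffD1, THEN conjunct1, rule_format]) simp
    qed
    have "((\<lambda>v. v * (v ^ 3 * exp (- \<kappa> * v ^ 4 + 4 * ?c * v\<^sup>2))) \<longlongrightarrow> 0) at_top"
      using \<kappa> by real_asymp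
    from tendsto_mult_right_zero[OF this, of "1 / t"]
    show "((\<lambda>v. v * (1 / t * (v ^ 3 * exp (- \<kappa> * v ^ 4 + 4 * ?c * v\<^sup>2)))) \<longlongrightarrow> 0) at_top"
      by (simp add: mult_ac)
    show "set_integrable lborel {0..} (\<lambda>v. 1 / t * (v ^ 3 * exp (- \<kappa> * v ^ 4 + 4 * ?c * v\<^sup>2)))"
      by (intro set_integrable_mult_right set_integrable_cubic_exp_quartic \<kappa>)
  qed simp
  have rot': "d y *\<^sub>R (LINT v:{0..}|lborel. cis 0 * f y (of_real v * cis 0))
      = d y *\<^sub>R (LINT v:{0..}|lborel. cis (pi / 8) * f y (of_real v * cis (pi / 8)))" for y
    using rot[of y] by (cases "y \<in> annulus \<and> y \<in> Omega") (auto simp: d_def)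
  have "ray_psi b t x 0 \<epsilon> (pw k) = (LINT y|lborel. d y *\<^sub>R (LINT v:{0..}|lborel. cis 0 * f y (of_real v * cis 0)))"
    by (rule iter) auto
  also have "\<dots> = (LINT y|lborel. d y *\<^sub>R (LINT v:{0..}|lborel. cis (pi / 8) * f y (of_real v * cis (pi / 8))))"
    by (simp only: rot')
  also have "\<dots> = ray_psi b t x (pi / 8) \<epsilon> (pw k)"
    by (rule iter[symmetric]) auto
  finally show ?thesis .
qed

text \<open>For |k| <= k0 every plane wave has growth constant at most k0, so one majorant in p
  times |h k| dominates on the product space. The condition on \<kappa> covers both uses: \<beta> =
  0 with \<epsilon> > 0, and \<beta> = pi/8 with \<epsilon> = 0.\<close>

lemma ray_psi_Fubini:
  fixes M :: "R2 measure"
  assumes "t > 0" "\<epsilon> \<ge> 0" "0 \<le> \<beta>" "\<beta> \<le> pi / 8" and "k0 \<ge> 0"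
    and \<kappa>: "0 < \<kappa>" "\<kappa> \<le> \<epsilon> * cos (4 * \<beta>) + sin (4 * \<beta>) / (4 * t)"
    and M: "sets M = sets borel" "finite_measure M" "integrable M h"
  shows "ray_psi b t x \<beta> \<epsilon> (\<lambda>z. cball_int k0 M h (\<lambda>k. pw k z))
    = cball_int k0 M h (\<lambda>k. ray_psi b t x \<beta> \<epsilon> (pw k))"
proof -
  interpret finite_measure M by fact
  interpret P: pair_sigma_finite "lborel :: (R2 \<times> real) measure" M ..
  note [measurable_cong] = M(1)
  have [measurable]: "h \<in> borel_measurable M" using M(3) by simp
  have [measurable]: "cball 0 k0 \<in> sets (borel :: R2 measure)" by simp
  define f where "f p k = ray_kernel b t x \<beta> \<epsilon> p * (indicator (cball 0 k0) k *\<^sub>R (pw k (ray_point \<beta> p) * h k))" for p k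
  have "integrable (lborel \<Otimes>\<^sub>M M) (case_prod f)"
  proof (rule Bochner_Integration.integrable_bound)
    show "integrable (lborel \<Otimes>\<^sub>M M) (\<lambda>q. (1 / t * majorant \<kappa> (2 * norm x / t + k0) (fst q)) * norm (h (snd q)))"
      using integrable_majorant[OF \<kappa>(1)] M(3)
      by (intro integrable_mult_pair) (auto simp: sigma_finite_lborel sigma_finite_measure_axioms)
    show "case_prod f \<in> borel_measurable (lborel \<Otimes>\<^sub>M M)"
      unfolding f_def by measurable
    have bnd: "norm (f p k) \<le> (1 / t * majorant \<kappa> (2 * norm x / t + k0) p) * norm (h k)" for p k
    proof (cases "k \<in> cball 0 k0")
      case True
      then have "norm (pw k (ray_point \<beta> p)) \<le> 1 * exp (k0 * norm (ray_point \<beta> p))"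
        by (intro order_trans[OF norm_pw_le]) (auto intro: mult_right_mono)
      from norm_ray_integrand_le[where F = "pw k", OF assms(1-4) \<kappa> this \<open>k0 \<ge> 0\<close>]
      have "norm (ray_kernel b t x \<beta> \<epsilon> p * pw k (ray_point \<beta> p)) * norm (h k)
          \<le> 1 / t * majorant \<kappa> (2 * norm x / t + k0) p * norm (h k)"
        by (intro mult_right_mono) auto
      then show ?thesis using True by (simp add: f_def norm_mult mult_ac)
    qed (use assms in \<open>simp add: f_def\<close>)
    show "AE q in lborel \<Otimes>\<^sub>M M. norm (case_prod f q)
        \<le> norm ((1 / t * majorant \<kappa> (2 * norm x / t + k0) (fst q)) * norm (h (snd q)))"
    proof (rule AE_I2)
      fix q
      show "norm (case_prod f q) \<le> norm ((1 / t * majorant \<kappa> (2 * norm x / t + k0) (fst q)) * norm (h (snd q)))"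
        using order_trans[OF bnd[of "fst q" "snd q"] abs_ge_self] by (simp only: case_prod_beta real_norm_def)
    qed
  qed
  from P.Fubini_integral[OF this]
  have "(LINT p|lborel. LINT k|M. f p k) = (LINT k|M. LINT p|lborel. f p k)" by simp
  moreover have "(LINT k|M. f p k) = ray_kernel b t x \<beta> \<epsilon> p * cball_int k0 M h (\<lambda>k. pw k (ray_point \<beta> p))" for p
    unfolding f_def cball_int_def set_lebesgue_integral_def by (rule integral_mult_right_zero)
  moreover have "(LINT p|lborel. f p k) = indicator (cball 0 k0) k *\<^sub>R (ray_psi b t x \<beta> \<epsilon> (pw k) * h k)" for k
  proof -
    have "f p k = indicator (cball 0 k0) k *\<^sub>R ((ray_kernel b t x \<beta> \<epsilon> p * pw k (ray_point \<beta> p)) * h k)" for p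
      by (simp add: f_def mult.assoc)
    then show ?thesis by (simp add: ray_psi_def)
  qed
  ultimately show ?thesis
    by (simp add: ray_psi_def cball_int_def set_lebesgue_integral_def)
qed

text \<open>At \<beta> = 0 the ray point is the real point w^2 y, so \<open>integral_polar\<close>
  turns the planar integral into the unrotated ray integral.\<close>

lemma damped_integral_eq_ray_psi:
  assumes "x \<in> Omega" and [measurable]: "F \<in> borel_measurable borel"
  shows "(LINT y:Omega|lborel. complex_of_real (exp (- \<epsilon> * (norm y)\<^sup>2)) * Green b t x y * F (embC2 y))
    = ray_psi b t x 0 \<epsilon> F"
proof -
  have [measurable]: "embC2 \<in> borel_measurable borel"
    unfolding embC2_def by measurable
  define f where "f y = indicator Omega y *\<^sub>R (ray_green b t x \<epsilon> y 1 * F (embC2 y))" for y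
  have green1: "ray_green b t x \<epsilon> y 1 = complex_of_real (exp (- \<epsilon> * (norm y)\<^sup>2)) * Green b t x y" if "y \<in> Omega" for y
    using ray_green_eq[OF assms(1) that, of 1] by simp
  have "(LINT y:Omega|lborel. complex_of_real (exp (- \<epsilon> * (norm y)\<^sup>2)) * Green b t x y * F (embC2 y)) = (LINT y|lborel. f y)"
    unfolding set_lebesgue_integral_def f_def
    by (intro Bochner_Integration.integral_cong) (auto simp: green1 split: split_indicator)
  also have "\<dots> = (LINT p|lborel. polar_density p *\<^sub>R f ((snd p)\<^sup>2 *\<^sub>R fst p))"
    by (rule integral_polar) (unfold f_def, measurable)
  also have "\<dots> = ray_psi b t x 0 \<epsilon> F"
    unfolding ray_psi_def
  proof (intro Bochner_Integration.integral_cong refl)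
    fix p :: "R2 \<times> real"
    show "polar_density p *\<^sub>R f ((snd p)\<^sup>2 *\<^sub>R fst p) = ray_kernel b t x 0 \<epsilon> p * F (ray_point 0 p)"
    proof (cases "snd p > 0 \<and> fst p \<in> Omega")
      case True
      then have "(snd p)\<^sup>2 *\<^sub>R fst p \<in> Omega" by (simp add: Omega_scaleR)
      then have "f ((snd p)\<^sup>2 *\<^sub>R fst p) = ray_green b t x \<epsilon> (fst p) (of_real (snd p)) * F (ray_point 0 p)"
        using True assms(1) by (simp add: f_def green1 ray_green_eq embC2_def ray_point_def)
      then show ?thesis using True by (simp add: ray_kernel_def)
    next
      case False
      \<comment> \<open>For w <= 0 the density vanishes, at w = 0 through w^3; for w > 0 scaling
        preserves the cut.\<close>
      then have "polar_density p = 0 \<or> (fst p \<notin> Omega \<and> (snd p)\<^sup>2 *\<^sub>R fst p \<notin> Omega)"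
        by (cases "snd p = 0") (auto simp: polar_density_def indicator_def Omega_scaleR)
      then show ?thesis by (auto simp: f_def ray_kernel_def)
    qed
  qed
  finally show ?thesis .
qed

text \<open>At angle pi/8 the damping factor has modulus 1, so the majorant with rate 1/(4t) serves
  all \<epsilon> and dominated convergence applies.\<close>

lemma tendsto_ray_psi:
  assumes "t > 0" and [measurable]: "F \<in> borel_measurable borel"
    and F: "\<And>z. norm (F z) \<le> A * exp (B * norm z)" and "B \<ge> 0"
  shows "((\<lambda>\<epsilon>. ray_psi b t x (pi / 8) \<epsilon> F) \<longlongrightarrow> ray_psi b t x (pi / 8) 0 F) (at_right 0)"
proof (rule tendsto_at_right_sequentially[of _ 1])
  fix S :: "nat \<Rightarrow> real" assume S: "\<And>n. 0 < S n" "S \<longlonglongrightarrow> 0"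
  show "(\<lambda>n. ray_psi b t x (pi / 8) (S n) F) \<longlonglongrightarrow> ray_psi b t x (pi / 8) 0 F"
    unfolding ray_psi_def
  proof (rule integral_dominated_convergence)
    show "integrable lborel (\<lambda>p. A / t * majorant (1 / (4 * t)) (2 * norm x / t + B) p)"
      using integrable_majorant[of "1 / (4 * t)"] \<open>t > 0\<close> by simp
    show "AE p in lborel. norm (ray_kernel b t x (pi / 8) (S n) p * F (ray_point (pi / 8) p))
        \<le> A / t * majorant (1 / (4 * t)) (2 * norm x / t + B) p" for n
      using S(1)[of n] assms by (intro AE_I2 norm_ray_integrand_le) auto
    show "AE p in lborel. (\<lambda>n. ray_kernel b t x (pi / 8) (S n) p * F (ray_point (pi / 8) p))
        \<longlonglongrightarrow> ray_kernel b t x (pi / 8) 0 p * F (ray_point (pi / 8) p)"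
      unfolding ray_kernel_def ray_green_def
      by (intro AE_I2 tendsto_intros S(2))
  qed measurable
qed simp

text \<open>Continuity with respect to A1 convergence: applied to a difference, A is the weighted
  sup distance, and the integral depends only on t, |x| and B.\<close>

lemma norm_ray_psi_le:
  assumes "t > 0" and [measurable]: "F \<in> borel_measurable borel"
    and F: "\<And>z. norm (F z) \<le> A * exp (B * norm z)" and "B \<ge> 0"
  shows "norm (ray_psi b t x (pi / 8) 0 F) \<le> A / t * (LINT p|lborel. majorant (1 / (4 * t)) (2 * norm x / t + B) p)"
proof -
  have "norm (ray_psi b t x (pi / 8) 0 F) \<le> (LINT p|lborel. A / t * majorant (1 / (4 * t)) (2 * norm x / t + B) p)"
    unfolding ray_psi_def
  proof (rule Bochner_Integration.integral_norm_bound_integral)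
    show "integrable lborel (\<lambda>p. ray_kernel b t x (pi / 8) 0 p * F (ray_point (pi / 8) p))"
      using assms by (intro integrable_ray_integrand[where \<kappa> = "1 / (4 * t)"]) auto
    show "integrable lborel (\<lambda>p. A / t * majorant (1 / (4 * t)) (2 * norm x / t + B) p)"
      using integrable_majorant[of "1 / (4 * t)"] \<open>t > 0\<close> by simp
    show "norm (ray_kernel b t x (pi / 8) 0 p * F (ray_point (pi / 8) p))
        \<le> A / t * majorant (1 / (4 * t)) (2 * norm x / t + B) p" for p
      using assms by (intro norm_ray_integrand_le) auto
  qed
  then show ?thesis by simp
qed

subsection \<open>The wave function\<close>

text \<open>The rotation is a hypothesis because it is obtained in two ways, by holomorphy for plane
  waves and by Fubini for superpositions. The limit is shown to exist, which determines the
  \<open>Lim\<close> in \<open>Psi\<close>.\<close>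

lemma Psi_eq_ray_psi:
  assumes "t > 0" "x \<in> Omega" and meas: "F \<in> borel_measurable borel"
    and F: "\<And>z. norm (F z) \<le> A * exp (B * norm z)" "B \<ge> 0"
    and rot: "\<And>\<epsilon>. \<epsilon> > 0 \<Longrightarrow> ray_psi b t x 0 \<epsilon> F = ray_psi b t x (pi / 8) \<epsilon> F"
  shows "Psi b t x F = ray_psi b t x (pi / 8) 0 F"
  unfolding Psi_def damped_integral_eq_ray_psi[OF \<open>x \<in> Omega\<close> meas]
proof (rule tendsto_Lim)
  show "((\<lambda>\<epsilon>. ray_psi b t x 0 \<epsilon> F) \<longlongrightarrow> ray_psi b t x (pi / 8) 0 F) (at_right 0)"
    using tendsto_ray_psi[OF \<open>t > 0\<close> meas F]
    by (rule Lim_transform_eventually)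
       (use eventually_at_right_less[of "0::real"] in eventually_elim, simp add: rot)
qed simp

lemma Psi_pw:
  assumes "t > 0" "x \<in> Omega"
  shows "Psi b t x (pw k) = ray_psi b t x (pi / 8) 0 (pw k)"
  using assms
  by (intro Psi_eq_ray_psi[where A = 1 and B = "norm k"] ray_psi_rotate) (auto intro: norm_pw_le)

section \<open>Superpositions of plane waves and the supershift\<close>

lemma cball_int_pw_measurable:
  fixes M :: "R2 measure"
  assumes "sets M = sets borel" "finite_measure M" "integrable M h"
  shows "(\<lambda>z. cball_int k0 M h (\<lambda>k. pw k z)) \<in> borel_measurable borel"
proof -
  interpret finite_measure M by fact
  note [measurable_cong] = assms(1)
  have [measurable]: "h \<in> borel_measurable M" using assms(3) by simp
  have [measurable]: "cball 0 k0 \<in> sets (borel :: R2 measure)" by simp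
  show ?thesis
    unfolding cball_int_def set_lebesgue_integral_def by measurable
qed

text \<open>The growth constant k0 is common to all superpositions, while the prefactor, the mass of
  |h| dM, may be unbounded along a sequence. The bound therefore yields integrability for each n;
  uniformity comes from the A1 hypothesis.\<close>

lemma norm_cball_int_pw_le:
  fixes M :: "R2 measure"
  assumes "sets M = sets borel" "integrable M h"
  shows "norm (cball_int k0 M h (\<lambda>k. pw k z)) \<le> (LINT k|M. norm (h k)) * exp (k0 * norm z)"
proof -
  note [measurable_cong] = assms(1)
  have [measurable]: "h \<in> borel_measurable M" using assms(2) by simp
  have "norm (indicator (cball 0 k0) k *\<^sub>R (pw k z * h k)) \<le> exp (k0 * norm z) * norm (h k)" for k
  proof (cases "k \<in> cball 0 k0")
    case True
    then have "norm (pw k z) \<le> exp (k0 * norm z)"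
      by (intro order_trans[OF norm_pw_le]) (auto intro: mult_right_mono)
    then show ?thesis using True by (auto simp: norm_mult intro: mult_right_mono)
  qed simp
  note bnd = this
  have "norm (cball_int k0 M h (\<lambda>k. pw k z)) \<le> (LINT k|M. exp (k0 * norm z) * norm (h k))"
    unfolding cball_int_def set_lebesgue_integral_def
  proof (rule Bochner_Integration.integral_norm_bound_integral)
    show int: "integrable M (\<lambda>k. exp (k0 * norm z) * norm (h k))" using assms by simp
    show "integrable M (\<lambda>k. indicator (cball 0 k0) k *\<^sub>R (pw k z * h k))"
      by (rule Bochner_Integration.integrable_bound[OF int]) (measurable, use bnd in auto)
  qed (rule bnd)
  then show ?thesis by (simp add: mult.commute)
qed

text \<open>A complex Borel measure is encoded as h dM with M finite and h integrable, which by
  polar decomposition covers every such measure.\<close>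

theorem theorem4p3:
  fixes k0 :: real and M :: "nat \<Rightarrow> R2 measure" and h :: "nat \<Rightarrow> R2 \<Rightarrow> complex"
    and F :: "nat \<Rightarrow> C2 \<Rightarrow> complex" and a :: R2
  assumes k0: "k0 > 0"
    and M_borel: "\<And>n. sets (M n) = sets borel"
    and M_fin: "\<And>n. finite_measure (M n)"
    and h_int: "\<And>n. integrable (M n) (h n)"
    and F_def: "\<And>n z. F n z = cball_int k0 (M n) (h n) (\<lambda>k. pw k z)"
    and a: "norm a > k0"
    and conv: "A1_conv F (pw a)"
  shows "(\<forall>b t x n. t > 0 \<longrightarrow> x \<in> Omega \<longrightarrow>
            Psi b t x (F n) = cball_int k0 (M n) (h n) (\<lambda>k. Psi b t x (pw k))) \<and>
         (\<forall>b K. compact K \<longrightarrow> K \<subseteq> {0<..} \<times> Omega \<longrightarrow>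
            uniform_limit K (\<lambda>n (t, x). Psi b t x (F n)) (\<lambda>(t, x). Psi b t x (pw a)) sequentially)"
proof -
  have F_eq: "F n = (\<lambda>z. cball_int k0 (M n) (h n) (\<lambda>k. pw k z))" for n
    by (rule ext) (rule F_def)
  have F_meas [measurable]: "F n \<in> borel_measurable borel" for n
    unfolding F_eq by (rule cball_int_pw_measurable[OF M_borel M_fin h_int])
  have F_le: "norm (F n z) \<le> (LINT k|M n. norm (h n k)) * exp (k0 * norm z)" for n z
    unfolding F_def by (rule norm_cball_int_pw_le[OF M_borel h_int])
  have Fubini: "ray_psi b t x \<beta> \<epsilon> (F n) = cball_int k0 (M n) (h n) (\<lambda>k. ray_psi b t x \<beta> \<epsilon> (pw k))"
    if "t > 0" "\<epsilon> \<ge> 0" "0 \<le> \<beta>" "\<beta> \<le> pi / 8" "0 < \<epsilon> * cos (4 * \<beta>) + sin (4 * \<beta>) / (4 * t)" for b t x \<beta> \<epsilon> n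
    unfolding F_eq using k0 by (intro ray_psi_Fubini[OF that(1-4) _ that(5) order_refl M_borel M_fin h_int]) simp
  have Psi_F: "Psi b t x (F n) = ray_psi b t x (pi / 8) 0 (F n)" if tx: "t > 0" "x \<in> Omega" for b t x n
  proof (rule Psi_eq_ray_psi[OF tx F_meas F_le])
    show "ray_psi b t x 0 \<epsilon> (F n) = ray_psi b t x (pi / 8) \<epsilon> (F n)" if "\<epsilon> > 0" for \<epsilon>
      using that tx by (simp add: Fubini ray_psi_rotate)
  qed (use k0 in simp)
  have "Psi b t x (F n) = cball_int k0 (M n) (h n) (\<lambda>k. Psi b t x (pw k))" if "t > 0" "x \<in> Omega" for b t x n
    using that by (simp add: Psi_F Fubini Psi_pw)
  moreover have "uniform_limit K (\<lambda>n (t, x). Psi b t x (F n)) (\<lambda>(t, x). Psi b t x (pw a)) sequentially"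
    if K: "compact K" "K \<subseteq> {0<..} \<times> Omega" for b K
  \<comment> \<open>A nonempty K is needed for the least time \<tau> to be attained.\<close>
  proof (cases "K = {}")
    case False
    have "compact (fst ` K)" "compact (snd ` K)"
      using K(1) by (auto intro!: compact_continuous_image continuous_intros)
    then obtain T R where T: "\<And>s. s \<in> fst ` K \<Longrightarrow> norm s \<le> T" and R: "\<And>x. x \<in> snd ` K \<Longrightarrow> norm x \<le> R"
      by (meson bounded_iff compact_imp_bounded)
    obtain \<tau> where \<tau>: "\<tau> \<in> fst ` K" "\<And>s. s \<in> fst ` K \<Longrightarrow> \<tau> \<le> s"
      using compact_attains_inf[OF \<open>compact (fst ` K)\<close>] False by auto
    have \<tau>_pos: "\<tau> > 0" using \<tau>(1) K(2) by auto
    have T_pos: "T > 0" using T[OF \<tau>(1)] \<tau>_pos by simp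
    obtain B where B: "B \<ge> 0" and ev: "\<And>\<delta>. \<delta> > 0 \<Longrightarrow>
        \<forall>\<^sub>F n in sequentially. \<forall>z. norm (F n z - pw a z) * exp (- B * norm z) \<le> \<delta>"
      using conv unfolding A1_conv_def by blast
    \<comment> \<open>The worst case over K: the prefactor 1/t is largest at \<tau>, the decay rate
      1/(4t) smallest at T, and the growth 2 |x| / t at most 2 R / \<tau>.\<close>
    define C where "C = 1 / \<tau> * (LINT p|lborel. majorant (1 / (4 * T)) (2 * R / \<tau> + B) p)"
    have C: "C \<ge> 0" using \<tau>_pos by (simp add: C_def)
    have bound: "norm (Psi b t x (F n) - Psi b t x (pw a)) \<le> \<delta> * C"
      if tx: "(t, x) \<in> K" and n: "\<And>z. norm (F n z - pw a z) \<le> \<delta> * exp (B * norm z)" and "\<delta> > 0" for n t x \<delta>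
    proof -
      have t: "\<tau> \<le> t" "t \<le> T" "t > 0" and x: "norm x \<le> R" "x \<in> Omega"
        using \<tau>(2) T R tx K(2) by force+
      \<comment> \<open>Linearity requires integrability of each term with its own growth constant,
        k0 and |a|; the difference is then estimated with the constant B of the A1
        convergence.\<close>
      have int: "integrable lborel (\<lambda>p. ray_kernel b t x (pi / 8) 0 p * F n (ray_point (pi / 8) p))"
        "integrable lborel (\<lambda>p. ray_kernel b t x (pi / 8) 0 p * pw a (ray_point (pi / 8) p))"
        by (rule integrable_ray_integrand[where \<kappa> = "1 / (4 * t)", OF _ _ _ _ _ _ F_meas F_le];
              use t(3) k0 in simp)
           (rule integrable_ray_integrand[where \<kappa> = "1 / (4 * t)" and A = 1 and B = "norm a"];
              use t(3) in \<open>auto intro: norm_pw_le\<close>)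
      have "Psi b t x (F n) - Psi b t x (pw a) = ray_psi b t x (pi / 8) 0 (\<lambda>z. F n z - pw a z)"
        unfolding Psi_F[OF t(3) x(2)] Psi_pw[OF t(3) x(2)] ray_psi_def
        by (simp add: right_diff_distrib Bochner_Integration.integral_diff[OF int])
      also have "norm \<dots> \<le> \<delta> / t * (LINT p|lborel. majorant (1 / (4 * t)) (2 * norm x / t + B) p)"
        by (rule norm_ray_psi_le[OF t(3) _ n B]) measurable
      also have "\<dots> \<le> \<delta> / \<tau> * (LINT p|lborel. majorant (1 / (4 * T)) (2 * R / \<tau> + B) p)"
      proof (rule mult_mono)
        show "(LINT p|lborel. majorant (1 / (4 * t)) (2 * norm x / t + B) p)
            \<le> (LINT p|lborel. majorant (1 / (4 * T)) (2 * R / \<tau> + B) p)"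
        proof (rule integral_mono)
          have "2 * norm x / t \<le> 2 * R / \<tau>" using t x \<tau>_pos by (intro frac_le) (auto intro: order_trans[OF norm_ge_zero])
          moreover have "1 / (4 * T) \<le> 1 / (4 * t)" using t by (intro divide_left_mono) auto
          ultimately show "majorant (1 / (4 * t)) (2 * norm x / t + B) p \<le> majorant (1 / (4 * T)) (2 * R / \<tau> + B) p" for p
            by (intro majorant_mono) auto
        qed (use t T_pos in \<open>auto intro: integrable_majorant\<close>)
      qed (use t \<tau>_pos \<open>\<delta> > 0\<close> in \<open>auto intro: divide_left_mono\<close>)
      finally show ?thesis by (simp add: C_def)
    qed
    show ?thesis
    proof (rule uniform_limitI)
      fix e :: real assume e: "e > 0"
      \<comment> \<open>Dividing by C + 1 keeps the tolerance meaningful when C = 0 and makes the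
        final inequality strict.\<close>
      have \<delta>: "e / (C + 1) > 0" "e / (C + 1) * C < e" using e C by (auto simp: field_simps)
      show "\<forall>\<^sub>F n in sequentially. \<forall>p\<in>K. dist (case p of (t, x) \<Rightarrow> Psi b t x (F n)) (case p of (t, x) \<Rightarrow> Psi b t x (pw a)) < e"
        using ev[OF \<delta>(1)]
      proof eventually_elim
        case (elim n)
        have n: "norm (F n z - pw a z) \<le> e / (C + 1) * exp (B * norm z)" for z
        proof -
          have "norm (F n z - pw a z) = norm (F n z - pw a z) * exp (- B * norm z) * exp (B * norm z)"
            by (simp add: mult.assoc flip: exp_add)
          also have "\<dots> \<le> e / (C + 1) * exp (B * norm z)"
            by (rule mult_right_mono[OF elim[rule_format]]) simp
          finally show ?thesis .
        qed
        show ?case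
        proof (intro ballI)
          fix p assume "p \<in> K"
          then have "norm (Psi b (fst p) (snd p) (F n) - Psi b (fst p) (snd p) (pw a)) \<le> e / (C + 1) * C"
            using bound[OF _ n \<delta>(1)] by (metis prod.collapse)
          then show "dist (case p of (t, x) \<Rightarrow> Psi b t x (F n)) (case p of (t, x) \<Rightarrow> Psi b t x (pw a)) < e"
            using \<delta>(2) by (simp add: dist_norm case_prod_beta)
        qed
      qed
    qed
  qed (simp add: uniform_limit_iff)
  ultimately show ?thesis by blast
qed

end
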